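(* Let $k\ge2$ and let $\mu_1,\ldots,\mu_k$ be non-zero, finite, compactly supported Borel measures on $\mathbb{R}^d$. If for some $p>1$ and $q\ge\max(2,p')$ one has $\mu_1*\cdots*\mu_k\in L^{\frac{q(p-1)}{q(p-1)-p}}(\mathbb{R}^d)$, then $$\big\|\widehat{f_1\,d\mu_1}\cdots\widehat{f_k\,d\mu_k}\big\|_{L^q(\mathbb{R}^d)}\lesssim\prod_{i=1}^k\|f_i\|_{L^p(d\mu_i)}$$ holds for all $f_i\in L^p(d\mu_i)$, $i=1,\ldots,k$. If $p=1$, then this estimate holds with $q=\infty$ without any assumption on $\mu_1*\cdots*\mu_k$.
   Context: For a finite Borel measure $\mu$ on $\mathbb{R}^d$ and $f\in L^1(\mu)$, $\widehat{f\,d\mu}(\xi)=\int f(x)e^{-2\pi i x\cdot\xi}\,d\mu(x)$. $p'$ is the Hölder conjugate exponent of $p$. $A\lesssim B$ means $A\le CB$ for a constant $0<C<\infty$, here independent of the functions $f_i$. A measure is said to be in $L^s(\mathbb{R}^d)$ if it is absolutely continuous with respect to Lebesgue measure with density in $L^s(\mathbb{R}^d)$. When $q=p'$, i.e. $q(p-1)-p=0$, the exponent $\frac{q(p-1)}{q(p-1)-p}$ is read as $\infty$. *)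

theory Defs
  imports "HOL-Probability.Probability"
begin

definition msupport :: "'a::topological_space measure \<Rightarrow> 'a set" where
  "msupport M = {x. \<forall>U. open U \<longrightarrow> x \<in> U \<longrightarrow> emeasure M U \<noteq> 0}"

definition fourier_measure ::
  "('a::euclidean_space \<Rightarrow> complex) \<Rightarrow> 'a measure \<Rightarrow> 'a \<Rightarrow> complex" where
  "fourier_measure f M \<xi> = (\<integral>x. f x * exp (- 2 * complex_of_real pi * \<i> * complex_of_real (x \<bullet> \<xi>)) \<partial>M)"

text \<open>The \<open>L\<^sup>p\<close> norm for \<open>1 \<le> p \<le> \<infinity>\<close>, with values in \<open>[0, \<infinity>]\<close>. The case distinction
  on the integral makes up for the missing power function on \<^typ>\<open>ennreal\<close>.\<close>

definition Lp_norm :: "ennreal \<Rightarrow> 'a measure \<Rightarrow> ('a \<Rightarrow> 'b::real_normed_vector) \<Rightarrow> ennreal" where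
  "Lp_norm p M f =
    (if p = \<infinity> then esssup M (\<lambda>x. ennreal (norm (f x)))
     else let I = (\<integral>\<^sup>+x. ennreal (norm (f x) powr enn2real p) \<partial>M)
          in if I = \<infinity> then \<infinity> else ennreal (enn2real I powr (1 / enn2real p)))"

text \<open>Functions, not classes modulo almost everywhere equality.\<close>

definition Lp_space :: "ennreal \<Rightarrow> 'a measure \<Rightarrow> ('a \<Rightarrow> 'b::real_normed_vector) set" where
  "Lp_space p M = {f \<in> borel_measurable M. Lp_norm p M f < \<infinity>}"

definition measure_in_Lp :: "ennreal \<Rightarrow> 'a::euclidean_space measure \<Rightarrow> bool" where
  "measure_in_Lp s M \<longleftrightarrow>
    (\<exists>g :: 'a \<Rightarrow> real. (\<forall>x. 0 \<le> g x) \<and> g \<in> Lp_space s lborel \<and>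
       M = density lborel (\<lambda>x. ennreal (g x)))"

text \<open>The convolution \<open>\<mu>\<^sub>1 * \<dots> * \<mu>\<^sub>k\<close> for \<open>k \<ge> 1\<close>.\<close>

definition iterated_convolution ::
  "(nat \<Rightarrow> 'a::ordered_euclidean_space measure) \<Rightarrow> nat \<Rightarrow> 'a measure" where
  "iterated_convolution \<mu> k = foldl convolution (\<mu> 1) (map \<mu> [2..<Suc k])"

definition hoelder_conjugate :: "real \<Rightarrow> real" where
  "hoelder_conjugate p = p / (p - 1)"

definition convolution_exponent :: "real \<Rightarrow> real \<Rightarrow> ennreal" where
  "convolution_exponent p q =
    (if q * (p - 1) - p = 0 then \<infinity> else ennreal (q * (p - 1) / (q * (p - 1) - p)))"

end

theory Submission
  imports Defs
begin

text \<open>Let \<open>P\<close> be the product of the \<open>\<mu>\<^sub>i\<close>, \<open>S\<close> the sum map, and \<open>g\<close> the density of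
  \<open>\<mu>\<^sub>1 * \<dots> * \<mu>\<^sub>k\<close>, the image of \<open>P\<close> under \<open>S\<close>. The product of the Fourier transforms is the
  transform of the image \<open>F\<close> of the complex measure \<open>f\<^sub>1 \<otimes> \<dots> \<otimes> f\<^sub>k \<cdot> P\<close>. If \<open>H\<close> is the
  density of the image of \<open>\<bar>f\<^sub>1 \<otimes> \<dots> \<otimes> f\<^sub>k\<bar>\<^sup>p \<cdot> P\<close>, then, up to a constant,
  \<open>\<bar>F\<bar> \<le> H\<^sup>1\<^sup>/\<^sup>p g\<^sup>1\<^sup>/\<^sup>p\<^sup>'\<close>; as the integral of \<open>H\<close> is the product of the integrals of
  \<open>\<bar>f\<^sub>i\<bar>\<^sup>p\<close>, this bounds \<open>F\<close> in \<open>L\<^sup>q\<^sup>'\<close>, and the Hausdorff-Young inequality applies.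
  That inequality is needed only up to a constant, for nonnegative integrable functions; it
  follows from the trivial \<open>L\<^sup>1 \<rightarrow> L\<^sup>\<infinity>\<close> bound and Plancherel by real interpolation.\<close>

section \<open>Plancherel and Hausdorff-Young\<close>

definition wave :: "'a::euclidean_space \<Rightarrow> 'a \<Rightarrow> complex" where
  "wave x \<xi> = exp (- 2 * complex_of_real pi * \<i> * complex_of_real (x \<bullet> \<xi>))"

lemma norm_wave [simp]: "norm (wave x \<xi>) = 1"
  by (simp add: wave_def)

lemma wave_add: "wave (x + y) \<xi> = wave x \<xi> * wave y \<xi>"
  by (simp add: wave_def inner_add_left distrib_left flip: exp_add)

lemma wave_diff: "wave (x - y) \<xi> = wave x \<xi> * cnj (wave y \<xi>)"
  by (simp add: wave_def inner_diff_left exp_cnj algebra_simps flip: exp_add)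

lemma wave_zero [simp]: "wave 0 \<xi> = 1"
  by (simp add: wave_def)

lemma wave_sum: "wave (\<Sum>i\<in>I. f i) \<xi> = (\<Prod>i\<in>I. wave (f i) \<xi>)"
  by (induction I rule: infinite_finite_induct) (simp_all add: wave_add)

lemma measurable_wave [measurable (raw)]:
  assumes "f \<in> borel_measurable M" "g \<in> borel_measurable M"
  shows "(\<lambda>x. wave (f x) (g x)) \<in> borel_measurable M"
  unfolding wave_def using assms by measurable

lemma fourier_measure_wave: "fourier_measure f M \<xi> = (\<integral>x. f x * wave x \<xi> \<partial>M)"
  by (simp add: fourier_measure_def wave_def)

lemma fourier_measure_measurable:
  assumes "sigma_finite_measure M" "sets M = sets borel" "f \<in> borel_measurable borel"
  shows "fourier_measure f M \<in> borel_measurable borel"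
proof -
  interpret sigma_finite_measure M by fact
  note [measurable_cong] = assms(2)
  note [measurable] = assms(3)
  have "(\<lambda>\<xi>. \<integral>x. f x * wave x \<xi> \<partial>M) \<in> borel_measurable borel"
    by measurable
  then show ?thesis by (simp add: fourier_measure_wave[abs_def])
qed

lemma fourier_measure_lborel_measurable [measurable (raw)]:
  "f \<in> borel_measurable borel \<Longrightarrow> fourier_measure f lborel \<in> borel_measurable borel"
  by (rule fourier_measure_measurable) (auto simp: lborel.sigma_finite_measure_axioms)

lemma norm_fourier_measure_le:
  "norm (fourier_measure f M \<xi>) \<le> (\<integral>x. norm (f x) \<partial>M)"
  unfolding fourier_measure_wave
  by (rule order_trans[OF integral_norm_bound]) (simp add: norm_mult)

section \<open>Gaussians and their Fourier transforms\<close>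

text \<open>Fubini in coordinates: \<open>lborel\<close> is the image of the product over
  \<open>Basis\<close> of one-dimensional Lebesgue measures. This reduces the Gaussian integrals to
  dimension one.\<close>

lemma lborel_integral_prod_Basis:
  fixes f :: "'a::euclidean_space \<Rightarrow> real \<Rightarrow> complex"
  assumes f: "\<And>b. b \<in> Basis \<Longrightarrow> integrable lborel (f b)"
  shows "(\<integral>x. (\<Prod>b\<in>Basis. f b (x \<bullet> b)) \<partial>lborel) = (\<Prod>b\<in>Basis. \<integral>t. f b t \<partial>lborel)"
proof -
  interpret product_sigma_finite "\<lambda>_::'a. lborel :: real measure" ..
  have [measurable]: "b \<in> Basis \<Longrightarrow> f b \<in> borel_measurable borel" for b
    using f[THEN borel_measurable_integrable] by simp
  have "(\<integral>x. (\<Prod>b\<in>Basis. f b (x \<bullet> b)) \<partial>lborel)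
      = (\<integral>y. (\<Prod>b\<in>Basis. f b ((\<Sum>c\<in>Basis. y c *\<^sub>R c) \<bullet> b)) \<partial>(\<Pi>\<^sub>M b\<in>Basis. lborel))"
    by (subst lborel_eq, subst integral_distr) auto
  also have "\<dots> = (\<integral>y. (\<Prod>b\<in>Basis. f b (y b)) \<partial>(\<Pi>\<^sub>M b\<in>Basis. lborel))"
    by (simp add: inner_sum_left inner_Basis if_distrib sum.delta cong: if_cong)
  also have "\<dots> = (\<Prod>b\<in>Basis. \<integral>t. f b t \<partial>lborel)"
    by (rule product_integral_prod) (auto simp: f)
  finally show ?thesis .
qed

lemma lborel_integrable_prod_Basis:
  fixes f :: "'a::euclidean_space \<Rightarrow> real \<Rightarrow> real"
  assumes f: "\<And>b. b \<in> Basis \<Longrightarrow> integrable lborel (f b)"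
  shows "integrable lborel (\<lambda>x::'a. \<Prod>b\<in>Basis. f b (x \<bullet> b))"
proof -
  interpret product_sigma_finite "\<lambda>_::'a. lborel :: real measure" ..
  have [measurable]: "b \<in> Basis \<Longrightarrow> f b \<in> borel_measurable borel" for b
    using f[THEN borel_measurable_integrable] by simp
  have *: "integrable (\<Pi>\<^sub>M b\<in>Basis. lborel) (\<lambda>y. \<Prod>b\<in>Basis. f b (y b))"
    by (rule product_integrable_prod) (auto simp: f)
  show ?thesis
    apply (subst lborel_eq, subst integrable_distr_eq)
      apply (auto simp: inner_sum_left inner_Basis if_distrib sum.delta * cong: if_cong)
    done
qed

text \<open>Substituting \<open>a * t\<close> for the variable turns the characteristic function of
  the standard normal distribution at \<open>- 2 * pi * z / a\<close> into this integral, up to the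
  factor \<open>sqrt (2 * pi) / a\<close>. That function is again Gaussian, so only constants remain
  to be matched.\<close>

lemma gaussian_fourier_real:
  assumes "a > 0"
  shows "(\<integral>t. complex_of_real (exp (- (a * t)\<^sup>2 / 2)) * wave z t \<partial>lborel)
    = complex_of_real (normal_density 0 (a / (2 * pi)) z)"
proof -
  have I: "integrable lborel (\<lambda>t. complex_of_real (std_normal_density t) * wave (z/a) t)"
    by (rule Bochner_Integration.integrable_bound[OF integrable_normal_density[of 1 0]])
       (auto simp: norm_mult)
  have "(\<integral>t. complex_of_real (std_normal_density t) * wave (z/a) t \<partial>lborel)
    = char std_normal_distribution (- 2 * pi * z / a)"
    unfolding char_def
    by (subst integral_density) (auto simp: normal_density_nonneg scaleR_conv_of_real wave_def
       inner_real_def algebra_simps)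
  also have "\<dots> = of_real (exp (- (2 * pi * z / a)\<^sup>2 / 2))"
    by (simp add: char_std_normal_distribution)
  finally have *: "(\<integral>t. complex_of_real (std_normal_density t) * wave (z/a) t \<partial>lborel)
    = of_real (exp (- (2 * pi * z / a)\<^sup>2 / 2))" .
  have "of_real (exp (- (2 * pi * z / a)\<^sup>2 / 2)) =
     \<bar>a\<bar> *\<^sub>R (\<integral>t. complex_of_real (std_normal_density (0 + a * t)) * wave (z/a) (0 + a * t) \<partial>lborel)"
    unfolding *[symmetric]
    by (rule lborel_integral_real_affine) (use assms in auto)
  also have "\<dots> = a *\<^sub>R (\<integral>t. (1 / sqrt (2 * pi)) *\<^sub>R
      (complex_of_real (exp (- (a * t)\<^sup>2 / 2)) * wave z t) \<partial>lborel)"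
    using assms
    by (simp add: std_normal_density_def wave_def inner_real_def scaleR_conv_of_real mult_ac)
  finally have "(\<integral>t. complex_of_real (exp (- (a * t)\<^sup>2 / 2)) * wave z t \<partial>lborel)
     = (sqrt (2 * pi) / a) *\<^sub>R of_real (exp (- (2 * pi * z / a)\<^sup>2 / 2))"
    using assms by simp
  also have "\<dots> = complex_of_real (normal_density 0 (a / (2 * pi)) z)"
  proof -
    have "sqrt (2 * pi * (a / (2 * pi))\<^sup>2) = a / sqrt (2 * pi)"
      using assms by (intro real_sqrt_unique) (auto simp: power_divide field_simps power2_eq_square)
    then have "normal_density 0 (a / (2 * pi)) z = sqrt (2 * pi) / a * exp (- (2 * pi * z / a)\<^sup>2 / 2)"
      using assms unfolding normal_density_def by (simp add: power_divide power_mult_distrib field_simps)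
    then show ?thesis
      by (simp add: scaleR_conv_of_real)
  qed
  finally show ?thesis .
qed

text \<open>The Fourier transform of a Gaussian of width \<open>1 / a\<close> is an \<open>L\<^sup>1\<close>-normalised Gaussian of
  width \<open>a / (2\<pi>)\<close>, so \<open>gauss a\<close> is an admissible convergence factor in Plancherel as
  \<open>a \<rightarrow> 0\<close>.\<close>

definition gauss :: "real \<Rightarrow> 'a::euclidean_space \<Rightarrow> real" where
  "gauss a \<xi> = (\<Prod>b\<in>Basis. exp (- (a * (\<xi> \<bullet> b))\<^sup>2 / 2))"

definition gauss_hat :: "real \<Rightarrow> 'a::euclidean_space \<Rightarrow> real" where
  "gauss_hat a z = (\<Prod>b\<in>Basis. normal_density 0 (a / (2 * pi)) (z \<bullet> b))"

lemma gauss_measurable [measurable]: "gauss a \<in> borel_measurable borel"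
  unfolding gauss_def[abs_def] by measurable

lemma gauss_hat_measurable [measurable]: "gauss_hat a \<in> borel_measurable borel"
  unfolding gauss_hat_def[abs_def] by measurable

lemma gauss_nonneg [simp]: "0 \<le> gauss a \<xi>"
  by (simp add: gauss_def prod_nonneg)

lemma gauss_hat_nonneg [simp]: "0 \<le> gauss_hat a \<xi>"
  by (simp add: gauss_hat_def prod_nonneg normal_density_nonneg)

lemma integrable_gauss_real:
  fixes a :: real
  assumes "a > 0" shows "integrable lborel (\<lambda>t. exp (- (a * t)\<^sup>2 / 2))"
proof -
  have "integrable lborel (\<lambda>t::real. sqrt (2 * pi) * std_normal_density (0 + a * t))"
    using assms by (intro integrable_mult_right lborel_integrable_real_affine) auto
  then show ?thesis by (simp add: std_normal_density_def)
qed

lemma integrable_gauss: "a > 0 \<Longrightarrow> integrable lborel (gauss a :: 'a::euclidean_space \<Rightarrow> real)"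
  unfolding gauss_def[abs_def]
  by (rule lborel_integrable_prod_Basis) (rule integrable_gauss_real)

lemma gauss_fourier:
  assumes "a > 0"
  shows "(\<integral>\<xi>. complex_of_real (gauss a \<xi>) * wave z \<xi> \<partial>lborel) = complex_of_real (gauss_hat a z)"
proof -
  \<comment> \<open>The inner product is a sum over coordinates, so the character is a product of
    one-dimensional characters.\<close>
  have w: "wave z \<xi> = (\<Prod>b\<in>Basis. wave (z \<bullet> b) (\<xi> \<bullet> b))" for \<xi>
  proof -
    have "wave z \<xi> = exp (- 2 * complex_of_real pi * \<i> * (\<Sum>b\<in>Basis. complex_of_real ((z \<bullet> b) * (\<xi> \<bullet> b))))"
      unfolding wave_def by (subst euclidean_inner) simp
    then show ?thesis
      by (simp add: wave_def exp_sum sum_distrib_left inner_real_def flip: sum_negf)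
  qed
  have "(\<integral>\<xi>. complex_of_real (gauss a \<xi>) * wave z \<xi> \<partial>lborel)
    = (\<integral>\<xi>. (\<Prod>b\<in>Basis. complex_of_real (exp (- (a * (\<xi> \<bullet> b))\<^sup>2 / 2)) * wave (z \<bullet> b) (\<xi> \<bullet> b)) \<partial>lborel)"
    by (simp add: gauss_def w prod.distrib)
  also have "\<dots> = (\<Prod>b\<in>Basis. \<integral>t. complex_of_real (exp (- (a * t)\<^sup>2 / 2)) * wave (z \<bullet> b) t \<partial>lborel)"
    by (rule lborel_integral_prod_Basis,
        rule Bochner_Integration.integrable_bound[OF integrable_gauss_real[OF assms]])
       (auto simp: norm_mult)
  also have "\<dots> = complex_of_real (gauss_hat a z)"
    by (simp only: gaussian_fourier_real[OF assms] gauss_hat_def of_real_prod)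
  finally show ?thesis .
qed

text \<open>Total mass 1, whatever \<open>a\<close> is, gives the constant 1 in
  \<open>plancherel_weighted\<close>.\<close>

lemma nn_integral_gauss_hat:
  assumes "a > 0"
  shows "(\<integral>\<^sup>+z. ennreal (gauss_hat a z) \<partial>(lborel :: 'a::euclidean_space measure)) = 1"
proof -
  have "(\<integral>\<^sup>+t. ennreal (normal_density 0 (a / (2 * pi)) t) \<partial>lborel) = 1"
    using assms by (subst nn_integral_eq_integral) (auto simp: normal_density_nonneg)
  then show ?thesis
    by (simp add: gauss_hat_def normal_density_nonneg nn_integral_lborel_prod[of "\<lambda>_ t. ennreal (normal_density 0 (a / (2 * pi)) t)"]
        flip: prod_ennreal)
qed

lemma gauss_tendsto_1: "(\<lambda>n. gauss (inverse (real (Suc n))) \<xi>) \<longlonglongrightarrow> 1"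
proof -
  have "(\<lambda>n. \<Prod>b\<in>Basis. exp (- (inverse (real (Suc n)) * (\<xi> \<bullet> b))\<^sup>2 / 2))
     \<longlonglongrightarrow> (\<Prod>b\<in>(Basis::'a set). exp (- (0 * (\<xi> \<bullet> b))\<^sup>2 / 2))"
    by (intro tendsto_intros LIMSEQ_inverse_real_of_nat) auto
  then show ?thesis by (simp add: gauss_def)
qed

section \<open>The Plancherel inequality for integrable functions\<close>

lemma lborel_nn_integral_translate:
  fixes c :: "'a::euclidean_space"
  assumes [measurable]: "f \<in> borel_measurable borel"
  shows "(\<integral>\<^sup>+x. f (c + x) \<partial>lborel) = (\<integral>\<^sup>+x. f x \<partial>lborel)"
  by (subst (2) lborel_distr_plus[of c, symmetric], subst nn_integral_distr) auto

lemma (in pair_sigma_finite)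
  fixes f g :: "_ \<Rightarrow> _::{real_normed_field, banach, second_countable_topology}"
  assumes f: "integrable M1 f" and g: "integrable M2 g"
  shows integrable_mult_fst_snd: "integrable (M1 \<Otimes>\<^sub>M M2) (\<lambda>z. f (fst z) * g (snd z))"
    and integral_mult_fst_snd: "(\<integral>z. f (fst z) * g (snd z) \<partial>(M1 \<Otimes>\<^sub>M M2)) = (\<integral>x. f x \<partial>M1) * (\<integral>y. g y \<partial>M2)"
proof -
  note [measurable] = borel_measurable_integrable[OF f] borel_measurable_integrable[OF g]
  show *: "integrable (M1 \<Otimes>\<^sub>M M2) (\<lambda>z. f (fst z) * g (snd z))"
    by (rule Fubini_integrable) (auto simp: norm_mult f g)
  show "(\<integral>z. f (fst z) * g (snd z) \<partial>(M1 \<Otimes>\<^sub>M M2)) = (\<integral>x. f x \<partial>M1) * (\<integral>y. g y \<partial>M2)"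
    using integral_fst'[OF *] by (simp add: f g)
qed

text \<open>The squared modulus is the transform times its conjugate. As \<open>F\<close> is real,
  conjugation affects only the character; Fubini merges the two integrals, and the characters
  combine to one at the difference.\<close>

lemma norm_fourier_square:
  fixes F :: "'a::euclidean_space \<Rightarrow> real"
  assumes F: "integrable lborel F"
  shows "complex_of_real ((norm (fourier_measure (\<lambda>x. complex_of_real (F x)) lborel \<xi>))\<^sup>2)
    = (\<integral>z. complex_of_real (F (fst z) * F (snd z)) * wave (fst z - snd z) \<xi> \<partial>(lborel \<Otimes>\<^sub>M lborel))"
proof -
  note [measurable] = borel_measurable_integrable[OF F, simplified]
  have I: "integrable lborel (\<lambda>x. complex_of_real (F x) * wave x \<xi>)"
    by (rule Bochner_Integration.integrable_bound[OF F]) (auto simp: norm_mult)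
  have J: "integrable lborel (\<lambda>x. complex_of_real (F x) * cnj (wave x \<xi>))"
    using integrable_cnj[OF I] by simp
  have "complex_of_real ((norm (fourier_measure (\<lambda>x. complex_of_real (F x)) lborel \<xi>))\<^sup>2)
    = (\<integral>x. complex_of_real (F x) * wave x \<xi> \<partial>lborel) * (\<integral>x. complex_of_real (F x) * cnj (wave x \<xi>) \<partial>lborel)"
    unfolding complex_norm_square fourier_measure_wave
    using Bochner_Integration.integral_cnj[of lborel "\<lambda>x. complex_of_real (F x) * wave x \<xi>"] by simp
  also have "\<dots> = (\<integral>z. (complex_of_real (F (fst z)) * wave (fst z) \<xi>) *
      (complex_of_real (F (snd z)) * cnj (wave (snd z) \<xi>)) \<partial>(lborel \<Otimes>\<^sub>M lborel))"
    by (rule lborel_pair.integral_mult_fst_snd[OF I J, symmetric])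
  finally show ?thesis
    by (simp add: wave_diff mult_ac)
qed

text \<open>The non-integrable case is trivial, the integral being 0 by convention.\<close>

lemma ennreal_norm_integral_le:
  fixes f :: "_ \<Rightarrow> _::{banach, second_countable_topology}"
  shows "ennreal (norm (\<integral>x. f x \<partial>M)) \<le> (\<integral>\<^sup>+x. ennreal (norm (f x)) \<partial>M)"
  by (cases "integrable M f") (auto simp: integral_norm_bound_ennreal not_integrable_integral_eq)

lemma gauss_hat_diff_commute: "gauss_hat a (x - y) = gauss_hat a (y - x)"
  by (simp add: gauss_hat_def normal_density_def inner_diff_left power2_commute)

text \<open>The Gaussian weight makes the integral over both copies of \<open>F\<close> and the
  frequency absolutely convergent. Integrating over the frequency first leaves a quadratic form in
  \<open>F\<close> with kernel \<open>gauss_hat a (x - y)\<close>. This kernel is nonnegative and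
  has mass 1 in each variable, so Schur's test bounds the form by the square integral of
  \<open>F\<close>.\<close>

lemma plancherel_weighted:
  fixes F :: "'a::euclidean_space \<Rightarrow> real"
  assumes F: "integrable lborel F" and a: "a > 0"
  shows "(\<integral>\<^sup>+\<xi>. ennreal ((norm (fourier_measure (\<lambda>x. complex_of_real (F x)) lborel \<xi>))\<^sup>2 * gauss a \<xi>) \<partial>lborel)
    \<le> (\<integral>\<^sup>+x. ennreal ((F x)\<^sup>2) \<partial>lborel)"
proof -
  note [measurable] = borel_measurable_integrable[OF F, simplified]
  let ?L = "lborel :: 'a measure"
  let ?G = "\<lambda>\<xi>. norm (fourier_measure (\<lambda>x. complex_of_real (F x)) lborel \<xi>)"
  have G[measurable]: "?G \<in> borel_measurable borel"
    by measurable
  interpret LL: pair_sigma_finite "?L \<Otimes>\<^sub>M ?L" ?L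
    by (simp add: pair_sigma_finite_def lborel.sigma_finite_measure_axioms lborel_prod)
  define T where "T = (\<lambda>z \<xi>. complex_of_real (F (fst z) * F (snd z)) * wave (fst z - snd z) \<xi> * complex_of_real (gauss a \<xi>))"
  have FF: "integrable (?L \<Otimes>\<^sub>M ?L) (\<lambda>z. F (fst z) * F (snd z))"
    by (rule lborel_pair.integrable_mult_fst_snd[OF F F])
  \<comment> \<open>The character has modulus 1, and the other factors separate into a function of
    the pair and a function of the frequency.\<close>
  have T: "integrable ((?L \<Otimes>\<^sub>M ?L) \<Otimes>\<^sub>M ?L) (case_prod T)"
  proof (rule Bochner_Integration.integrable_bound)
    show "integrable ((?L \<Otimes>\<^sub>M ?L) \<Otimes>\<^sub>M ?L) (\<lambda>w. (F (fst (fst w)) * F (snd (fst w))) * gauss a (snd w))"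
      by (rule LL.integrable_mult_fst_snd[OF FF integrable_gauss[OF a]])
  qed (auto simp: T_def case_prod_unfold norm_mult abs_mult)
  have translate': "(\<integral>\<^sup>+x. ennreal (gauss_hat a (x - y)) \<partial>?L) = 1"
    "(\<integral>\<^sup>+x. ennreal (gauss_hat a (y - x)) \<partial>?L) = 1" for y
  proof -
    show *: "(\<integral>\<^sup>+x. ennreal (gauss_hat a (x - y)) \<partial>?L) = 1"
      using lborel_nn_integral_translate[of "\<lambda>x. ennreal (gauss_hat a x)" "-y"]
        nn_integral_gauss_hat[OF a, where 'a='a] by simp
    then show "(\<integral>\<^sup>+x. ennreal (gauss_hat a (y - x)) \<partial>?L) = 1"
      by (subst gauss_hat_diff_commute)
  qed
  \<comment> \<open>The transform is bounded by the integral of \<open>norm (F x)\<close>, so the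
    weight alone ensures integrability.\<close>
  have int: "integrable lborel (\<lambda>\<xi>. (?G \<xi>)\<^sup>2 * gauss a \<xi>)"
  proof (rule Bochner_Integration.integrable_bound)
    show "integrable lborel (\<lambda>\<xi>. (\<integral>x. norm (F x) \<partial>lborel)\<^sup>2 * gauss a \<xi> :: real)"
      by (intro integrable_mult_right integrable_gauss a)
    show "AE \<xi> in lborel. norm ((?G \<xi>)\<^sup>2 * gauss a \<xi>) \<le> norm ((\<integral>x. norm (F x) \<partial>lborel)\<^sup>2 * gauss a \<xi>)"
      using norm_fourier_measure_le[of "\<lambda>x. complex_of_real (F x)" lborel]
      by (auto simp: abs_mult intro!: mult_right_mono power_mono)
  qed auto
  have "complex_of_real (\<integral>\<xi>. (?G \<xi>)\<^sup>2 * gauss a \<xi> \<partial>lborel)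
    = (\<integral>\<xi>. complex_of_real ((?G \<xi>)\<^sup>2) * complex_of_real (gauss a \<xi>) \<partial>lborel)"
    by (simp flip: integral_complex_of_real)
  also have "\<dots> = (\<integral>\<xi>. (\<integral>z. T z \<xi> \<partial>(?L \<Otimes>\<^sub>M ?L)) \<partial>lborel)"
    unfolding norm_fourier_square[OF F] T_def by simp
  also have "\<dots> = (\<integral>z. (\<integral>\<xi>. T z \<xi> \<partial>lborel) \<partial>(?L \<Otimes>\<^sub>M ?L))"
    by (rule LL.Fubini_integral) (rule T)
  also have "\<dots> = (\<integral>z. complex_of_real (F (fst z) * F (snd z)) *
      (\<integral>\<xi>. complex_of_real (gauss a \<xi>) * wave (fst z - snd z) \<xi> \<partial>lborel) \<partial>(?L \<Otimes>\<^sub>M ?L))"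
    unfolding T_def by (simp add: mult_ac flip: integral_mult_right_zero)
  also have "\<dots> = complex_of_real (\<integral>z. F (fst z) * F (snd z) * gauss_hat a (fst z - snd z) \<partial>(?L \<Otimes>\<^sub>M ?L))"
    unfolding gauss_fourier[OF a] by (simp flip: integral_complex_of_real)
  finally have eq: "(\<integral>\<xi>. (?G \<xi>)\<^sup>2 * gauss a \<xi> \<partial>lborel)
    = (\<integral>z. F (fst z) * F (snd z) * gauss_hat a (fst z - snd z) \<partial>(?L \<Otimes>\<^sub>M ?L))"
    by (simp only: of_real_eq_iff)
  have "(\<integral>\<^sup>+\<xi>. ennreal ((?G \<xi>)\<^sup>2 * gauss a \<xi>) \<partial>lborel) = ennreal (\<integral>\<xi>. (?G \<xi>)\<^sup>2 * gauss a \<xi> \<partial>lborel)"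
    by (rule nn_integral_eq_integral[OF int]) auto
  also have "\<dots> \<le> (\<integral>\<^sup>+z. ennreal (norm (F (fst z) * F (snd z) * gauss_hat a (fst z - snd z))) \<partial>(?L \<Otimes>\<^sub>M ?L))"
    unfolding eq by (rule order_trans[OF ennreal_leI[OF abs_ge_self]])
       (use ennreal_norm_integral_le[of "?L \<Otimes>\<^sub>M ?L" "\<lambda>z. F (fst z) * F (snd z) * gauss_hat a (fst z - snd z)"] in simp)
  \<comment> \<open>By the inequality of arithmetic and geometric means each summand contains
    \<open>F\<close> at one point only, and the kernel can be integrated out over the other
    variable.\<close>
  also have "\<dots> \<le> (\<integral>\<^sup>+z. ennreal ((F (fst z))\<^sup>2/2 * gauss_hat a (fst z - snd z))
       + ennreal ((F (snd z))\<^sup>2 / 2 * gauss_hat a (fst z - snd z)) \<partial>(?L \<Otimes>\<^sub>M ?L))"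
  proof (rule nn_integral_mono)
    fix z :: "'a \<times> 'a"
    have "\<bar>F (fst z)\<bar> * \<bar>F (snd z)\<bar> \<le> (F (fst z))\<^sup>2/2 + (F (snd z))\<^sup>2/2"
      using sum_squares_bound[of "\<bar>F (fst z)\<bar>" "\<bar>F (snd z)\<bar>"] by simp
    then have "\<bar>F (fst z)\<bar> * \<bar>F (snd z)\<bar> * gauss_hat a (fst z - snd z)
      \<le> (F (fst z))\<^sup>2/2 * gauss_hat a (fst z - snd z) + (F (snd z))\<^sup>2/2 * gauss_hat a (fst z - snd z)"
      by (metis distrib_right gauss_hat_nonneg mult_right_mono)
    then show "ennreal (norm (F (fst z) * F (snd z) * gauss_hat a (fst z - snd z)))
      \<le> ennreal ((F (fst z))\<^sup>2/2 * gauss_hat a (fst z - snd z))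
       + ennreal ((F (snd z))\<^sup>2 / 2 * gauss_hat a (fst z - snd z))"
      by (subst ennreal_plus[symmetric]) (auto simp: abs_mult simp del: ennreal_plus intro!: ennreal_leI)
  qed
  also have "\<dots> = (\<integral>\<^sup>+z. ennreal ((F (fst z))\<^sup>2/2 * gauss_hat a (fst z - snd z)) \<partial>(?L \<Otimes>\<^sub>M ?L))
     + (\<integral>\<^sup>+z. ennreal ((F (snd z))\<^sup>2 / 2 * gauss_hat a (fst z - snd z)) \<partial>(?L \<Otimes>\<^sub>M ?L))"
    by (rule nn_integral_add) auto
  also have "(\<integral>\<^sup>+z. ennreal ((F (fst z))\<^sup>2/2 * gauss_hat a (fst z - snd z)) \<partial>(?L \<Otimes>\<^sub>M ?L))
     = (\<integral>\<^sup>+x. \<integral>\<^sup>+y. ennreal ((F x)\<^sup>2/2) * ennreal (gauss_hat a (x - y)) \<partial>?L \<partial>?L)"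
    by (subst lborel.nn_integral_fst[symmetric]) (simp_all add: ennreal_mult'[symmetric])
  also have "\<dots> = (\<integral>\<^sup>+x. ennreal ((F x)\<^sup>2/2) \<partial>?L)"
    by (simp add: nn_integral_cmult translate')
  also have "(\<integral>\<^sup>+z. ennreal ((F (snd z))\<^sup>2/2 * gauss_hat a (fst z - snd z)) \<partial>(?L \<Otimes>\<^sub>M ?L))
     = (\<integral>\<^sup>+y. \<integral>\<^sup>+x. ennreal ((F y)\<^sup>2/2) * ennreal (gauss_hat a (x - y)) \<partial>?L \<partial>?L)"
    by (subst lborel_pair.nn_integral_snd[symmetric]) (simp_all add: ennreal_mult'[symmetric])
  also have "\<dots> = (\<integral>\<^sup>+x. ennreal ((F x)\<^sup>2/2) \<partial>?L)"
    using lborel_nn_integral_translate[of "\<lambda>x. ennreal (gauss_hat a x)"]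
      nn_integral_gauss_hat[OF a, where 'a='a]
    by (simp add: nn_integral_cmult translate')
  also have "(\<integral>\<^sup>+x. ennreal ((F x)\<^sup>2/2) \<partial>?L) + (\<integral>\<^sup>+x. ennreal ((F x)\<^sup>2/2) \<partial>?L) = (\<integral>\<^sup>+x. ennreal ((F x)\<^sup>2) \<partial>?L)"
    by (subst nn_integral_add[symmetric]) (auto simp flip: ennreal_plus)
  finally show ?thesis .
qed

text \<open>Fatou's lemma removes the weight: along \<open>a = 1 / (n + 1)\<close> it tends to 1
  pointwise, while the bound of \<open>plancherel_weighted\<close> does not depend on
  \<open>a\<close>.\<close>

lemma plancherel_le:
  fixes F :: "'a::euclidean_space \<Rightarrow> real"
  assumes F: "integrable lborel F"
  shows "(\<integral>\<^sup>+\<xi>. ennreal ((norm (fourier_measure (\<lambda>x. complex_of_real (F x)) lborel \<xi>))\<^sup>2) \<partial>lborel)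
    \<le> (\<integral>\<^sup>+x. ennreal ((F x)\<^sup>2) \<partial>lborel)"
proof -
  note [measurable] = borel_measurable_integrable[OF F, simplified]
  let ?G = "\<lambda>\<xi>. norm (fourier_measure (\<lambda>x. complex_of_real (F x)) lborel \<xi>)"
  have G[measurable]: "?G \<in> borel_measurable borel"
    by measurable
  let ?a = "\<lambda>n. inverse (real (Suc n))"
  have lim: "liminf (\<lambda>n. ennreal ((?G \<xi>)\<^sup>2 * gauss (?a n) \<xi>)) = ennreal ((?G \<xi>)\<^sup>2)" for \<xi>
    using tendsto_ennrealI[OF tendsto_mult[OF tendsto_const gauss_tendsto_1], of "(?G \<xi>)\<^sup>2" \<xi>]
    by (intro lim_imp_Liminf) simp_all
  have "(\<integral>\<^sup>+\<xi>. ennreal ((?G \<xi>)\<^sup>2) \<partial>lborel)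
      = (\<integral>\<^sup>+\<xi>. liminf (\<lambda>n. ennreal ((?G \<xi>)\<^sup>2 * gauss (?a n) \<xi>)) \<partial>lborel)"
    by (simp only: lim)
  also have "\<dots> \<le> liminf (\<lambda>n. \<integral>\<^sup>+\<xi>. ennreal ((?G \<xi>)\<^sup>2 * gauss (?a n) \<xi>) \<partial>lborel)"
    by (rule nn_integral_liminf) auto
  also have "\<dots> \<le> (\<integral>\<^sup>+x. ennreal ((F x)\<^sup>2) \<partial>lborel)"
    by (rule Liminf_le) (auto intro!: always_eventually plancherel_weighted F)
  finally show ?thesis .
qed

section \<open>Hausdorff-Young by real interpolation\<close>

lemma nn_integral_powr_Ioc:
  fixes c T :: real
  assumes "c > -1" "0 \<le> T"
  shows "(\<integral>\<^sup>+l. ennreal (l powr c) * indicator {0<..T} l \<partial>lborel) = ennreal (T powr (c + 1) / (c + 1))"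
proof -
  have "(\<integral>\<^sup>+l. ennreal (l powr c) * indicator {0<..T} l \<partial>lborel)
    = (\<integral>\<^sup>+l. ennreal (if l \<in> {0..T} then l powr c else 0) \<partial>lborel)"
    by (intro nn_integral_cong_AE eventually_mono[OF AE_lborel_singleton[of 0]])
       (auto split: split_indicator)
  also have "\<dots> = ennreal (T powr (c + 1) / (c + 1))"
    by (rule nn_integral_has_integral_lborel) (use has_integral_powr_from_0[OF assms] in \<open>auto simp only: has_integral_restrict_UNIV, auto\<close>)
  finally show ?thesis .
qed

text \<open>Real interpolation: at each level \<open>l\<close> truncate \<open>F\<close> at the height \<open>t l\<close>, chosen so that the
  discarded part has \<open>L\<^sup>1\<close> norm at most \<open>l / 2\<close>. The transform of the truncation thus
  exceeds half of the transform of \<open>F\<close> at all levels below the latter.\<close>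

lemma hausdorff_young_gt_2:
  fixes F :: "'a::euclidean_space \<Rightarrow> real" and q K :: real
  assumes q: "q > 2" and K: "K > 0"
    and F: "integrable lborel F" and nn: "\<And>x. 0 \<le> F x"
    and FK: "(\<integral>\<^sup>+x. ennreal (F x powr (q / (q - 1))) \<partial>lborel) \<le> ennreal K"
  shows "(\<integral>\<^sup>+\<xi>. ennreal (norm (fourier_measure (\<lambda>x. complex_of_real (F x)) lborel \<xi>) powr q) \<partial>lborel)
    \<le> ennreal (4 * (2 * K) powr (q - 2) * K)"
proof -
  note [measurable] = borel_measurable_integrable[OF F, simplified]
  \<comment> \<open>The height is chosen so that, for positive \<open>l\<close>,
    \<open>F x > t l\<close> is equivalent to
    \<open>l / (2 * K) * F x powr (1 / (q - 1)) > 1\<close>. Multiplied by \<open>F x\<close>, this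
    bounds the discarded part by \<open>l / (2 * K) * F x powr (q / (q - 1))\<close>, whose integral
    is at most \<open>l / 2\<close> by \<open>FK\<close>.\<close>
  define t :: "real \<Rightarrow> real" where "t l = (l / (2 * K)) powr (- (q - 1))" for l
  have [measurable]: "t \<in> borel_measurable borel"
    unfolding t_def by measurable
  define F2 where "F2 l x = (if F x \<le> t l then F x else 0)" for l x
  define W where "W l \<xi> = norm (fourier_measure (\<lambda>x. complex_of_real (F2 l x)) lborel \<xi>)" for l \<xi>
  let ?G = "\<lambda>\<xi>. norm (fourier_measure (\<lambda>x. complex_of_real (F x)) lborel \<xi>)"
  have F2_meas[measurable]: "(\<lambda>z. F2 (fst z) (snd z)) \<in> borel_measurable (borel \<Otimes>\<^sub>M borel)"
    unfolding F2_def by measurable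
  have W_meas[measurable]: "(\<lambda>z. W (fst z) (snd z)) \<in> borel_measurable (borel \<Otimes>\<^sub>M borel)"
    unfolding W_def fourier_measure_wave F2_def by measurable
  \<comment> \<open>Joint measurability is wanted in both orders of the variables, for the two
    exchanges of integration below.\<close>
  have [measurable]: "(\<lambda>z. W (snd z) (fst z)) \<in> borel_measurable (borel \<Otimes>\<^sub>M borel)"
      "(\<lambda>z. F2 (snd z) (fst z)) \<in> borel_measurable (borel \<Otimes>\<^sub>M borel)"
    using measurable_compose[OF measurable_pair_swap' W_meas] measurable_compose[OF measurable_pair_swap' F2_meas]
    by (simp_all add: case_prod_unfold)
  have G[measurable]: "?G \<in> borel_measurable borel"
    by measurable
  have int2: "integrable lborel (F2 l)" for l
    by (rule Bochner_Integration.integrable_bound[OF F]) (auto simp: F2_def[abs_def] nn)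
  have tail: "?G \<xi> \<le> l / 2 + W l \<xi>" if "l > 0" for l \<xi>
  proof -
    have int1: "integrable lborel (\<lambda>x. F x - F2 l x)"
      using F int2 by simp
    have nn1: "0 \<le> F x - F2 l x" for x
      by (simp add: F2_def nn)
    have t_pos: "t l > 0" using that K by (simp add: t_def)
    have "F x - F2 l x \<le> l / (2 * K) * F x powr (q / (q - 1))" for x
    proof (cases "F x \<le> t l")
      case False
      have "1 = (l / (2 * K)) * t l powr (1 / (q - 1))"
      proof -
        have "- (q - 1) * (1 / (q - 1)) = -1" using q by (simp add: field_simps)
        then show ?thesis
          using that K by (simp only: t_def powr_powr) (simp add: powr_minus_divide)
      qed
      also have "\<dots> \<le> (l / (2 * K)) * F x powr (1 / (q - 1))"
        using that K q False t_pos by (intro mult_left_mono powr_mono2) auto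
      finally have "F x * 1 \<le> F x * ((l / (2 * K)) * F x powr (1 / (q - 1)))"
        by (rule mult_left_mono) (rule nn)
      also have "\<dots> = (l / (2 * K)) * F x powr (1 + 1 / (q - 1))"
        using False t_pos by (simp add: powr_add)
      also have "1 + 1 / (q - 1) = q / (q - 1)"
        using q by (simp add: field_simps)
      finally show ?thesis using False by (simp add: F2_def)
    qed (use that K in \<open>simp add: F2_def\<close>)
    then have "(\<integral>\<^sup>+x. ennreal (F x - F2 l x) \<partial>lborel)
      \<le> (\<integral>\<^sup>+x. ennreal (l / (2 * K)) * ennreal (F x powr (q / (q - 1))) \<partial>lborel)"
      using that K by (intro nn_integral_mono) (simp add: ennreal_mult'[symmetric] ennreal_leI)
    also have "\<dots> = ennreal (l / (2 * K)) * (\<integral>\<^sup>+x. ennreal (F x powr (q / (q - 1))) \<partial>lborel)"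
      by (rule nn_integral_cmult) simp
    also have "\<dots> \<le> ennreal (l / (2 * K)) * ennreal K"
      by (intro mult_left_mono FK) simp
    also have "\<dots> = ennreal (l / 2)"
      using that K by (simp add: ennreal_mult'[symmetric])
    finally have le: "(\<integral>x. F x - F2 l x \<partial>lborel) \<le> l / 2"
      using nn_integral_eq_integral[OF int1] nn1 that by simp
    have "fourier_measure (\<lambda>x. complex_of_real (F x)) lborel \<xi>
      = fourier_measure (\<lambda>x. complex_of_real (F x - F2 l x)) lborel \<xi>
      + fourier_measure (\<lambda>x. complex_of_real (F2 l x)) lborel \<xi>"
    proof -
      have I: "integrable lborel (\<lambda>x. complex_of_real (f x) * wave x \<xi>)" if "integrable lborel f" for f :: "'a \<Rightarrow> real"
        by (rule Bochner_Integration.integrable_bound[OF that])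
           (use borel_measurable_integrable[OF that] in \<open>auto simp: norm_mult\<close>)
      show ?thesis
        unfolding fourier_measure_wave
        by (subst Bochner_Integration.integral_add[symmetric, OF I[OF int1] I[OF int2]])
           (simp add: algebra_simps)
    qed
    then have "?G \<xi> \<le> norm (fourier_measure (\<lambda>x. complex_of_real (F x - F2 l x)) lborel \<xi>) + W l \<xi>"
      by (simp add: W_def norm_triangle_ineq)
    also have "norm (fourier_measure (\<lambda>x. complex_of_real (F x - F2 l x)) lborel \<xi>) \<le> (\<integral>x. F x - F2 l x \<partial>lborel)"
      using norm_fourier_measure_le[of "\<lambda>x. complex_of_real (F x - F2 l x)" lborel \<xi>] nn1
      by (simp add: norm_of_real del: of_real_diff)
    finally show ?thesis using le by simp
  qed
  \<comment> \<open>For \<open>q > 2\<close> the weight \<open>l powr (q - 3)\<close> integrates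
    over \<open>{0<..g}\<close> to \<open>g powr (q - 2) / (q - 2)\<close>. On that range of levels,
    with \<open>g\<close> the value of \<open>?G\<close>, \<open>tail\<close> gives \<open>W\<close>
    at least \<open>g / 2\<close>; the factor 4 in \<open>pt\<close> makes up for the squared
    half.\<close>
  let ?w = "\<lambda>l::real. ennreal (l powr (q - 3)) * indicator {0<..} l"
  have pt: "ennreal (?G \<xi> powr q) \<le> ennreal (4 * (q - 2)) * (\<integral>\<^sup>+l. ?w l * ennreal ((W l \<xi>)\<^sup>2) \<partial>lborel)" for \<xi>
  proof (cases "?G \<xi> = 0")
    case False
    let ?g = "?G \<xi>"
    have g: "?g > 0" using False by simp
    have "?g powr q = ?g powr (q - 2 + 2)" by simp
    also have "\<dots> = ?g powr (q - 2) * ?g\<^sup>2"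
      using g unfolding powr_add by simp
    finally have "ennreal (?g powr q) = ennreal (4 * (q - 2)) * ennreal ((?g / 2)\<^sup>2) * ennreal (?g powr (q - 2) / (q - 2))"
      using q g by (simp add: ennreal_mult'[symmetric] power_divide)
    also have "ennreal (?g powr (q - 2) / (q - 2)) = (\<integral>\<^sup>+l. ennreal (l powr (q - 3)) * indicator {0<..?g} l \<partial>lborel)"
      using nn_integral_powr_Ioc[of "q - 3" ?g] q g by simp
    also have "ennreal (4 * (q - 2)) * ennreal ((?g / 2)\<^sup>2) * \<dots>
      = ennreal (4 * (q - 2)) * (\<integral>\<^sup>+l. ennreal ((?g / 2)\<^sup>2) * (ennreal (l powr (q - 3)) * indicator {0<..?g} l) \<partial>lborel)"
      by (subst nn_integral_cmult) (auto simp: mult.assoc)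
    also have "\<dots> \<le> ennreal (4 * (q - 2)) * (\<integral>\<^sup>+l. ?w l * ennreal ((W l \<xi>)\<^sup>2) \<partial>lborel)"
    proof (intro mult_left_mono nn_integral_mono)
      fix l :: real
      show "ennreal ((?g / 2)\<^sup>2) * (ennreal (l powr (q - 3)) * indicator {0<..?g} l) \<le> ?w l * ennreal ((W l \<xi>)\<^sup>2)"
      proof (cases "0 < l \<and> l \<le> ?g")
        case True
        then have "(?g / 2)\<^sup>2 \<le> (W l \<xi>)\<^sup>2"
          using tail[of l \<xi>] by (intro power_mono) auto
        then show ?thesis using True by (simp add: mult.commute[of _ "ennreal (l powr (q - 3))"] ennreal_leI mult_left_mono)
      qed auto
    qed simp
    finally show ?thesis .
  qed simp
  have "(\<integral>\<^sup>+\<xi>. ennreal (?G \<xi> powr q) \<partial>lborel)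
    \<le> (\<integral>\<^sup>+\<xi>. ennreal (4 * (q - 2)) * (\<integral>\<^sup>+l. ?w l * ennreal ((W l \<xi>)\<^sup>2) \<partial>lborel) \<partial>lborel)"
    by (intro nn_integral_mono pt)
  also have "\<dots> = ennreal (4 * (q - 2)) * (\<integral>\<^sup>+\<xi>. (\<integral>\<^sup>+l. ?w l * ennreal ((W l \<xi>)\<^sup>2) \<partial>lborel) \<partial>lborel)"
    by (rule nn_integral_cmult) measurable
  also have "(\<integral>\<^sup>+\<xi>. (\<integral>\<^sup>+l. ?w l * ennreal ((W l \<xi>)\<^sup>2) \<partial>lborel) \<partial>lborel)
    = (\<integral>\<^sup>+l. (\<integral>\<^sup>+\<xi>. ?w l * ennreal ((W l \<xi>)\<^sup>2) \<partial>lborel) \<partial>lborel)"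
    by (rule lborel_pair.Fubini') measurable
  \<comment> \<open>With the frequency integral inside, Plancherel applies to the truncation at each
    fixed level.\<close>
  also have "\<dots> \<le> (\<integral>\<^sup>+l. (\<integral>\<^sup>+x. ?w l * ennreal ((F2 l x)\<^sup>2) \<partial>lborel) \<partial>lborel)"
  proof (rule nn_integral_mono)
    fix l :: real
    have [measurable]: "F2 l \<in> borel_measurable borel" "W l \<in> borel_measurable borel"
      unfolding W_def F2_def by measurable
    show "(\<integral>\<^sup>+\<xi>. ?w l * ennreal ((W l \<xi>)\<^sup>2) \<partial>lborel) \<le> (\<integral>\<^sup>+x. ?w l * ennreal ((F2 l x)\<^sup>2) \<partial>lborel)"
      using plancherel_le[OF int2[of l]]
      by (simp add: nn_integral_cmult W_def mult_left_mono)
  qed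
  also have "\<dots> = (\<integral>\<^sup>+x. (\<integral>\<^sup>+l. ?w l * ennreal ((F2 l x)\<^sup>2) \<partial>lborel) \<partial>lborel)"
    by (rule lborel_pair.Fubini'[symmetric]) measurable
  also have "\<dots> \<le> (\<integral>\<^sup>+x. ennreal ((2 * K) powr (q - 2) / (q - 2)) * ennreal (F x powr (q / (q - 1))) \<partial>lborel)"
  proof (rule nn_integral_mono)
    fix x
    show "(\<integral>\<^sup>+l. ?w l * ennreal ((F2 l x)\<^sup>2) \<partial>lborel) \<le> ennreal ((2 * K) powr (q - 2) / (q - 2)) * ennreal (F x powr (q / (q - 1)))"
    proof (cases "F x = 0")
      case False
      then have pos: "F x > 0" using nn[of x] by simp
      \<comment> \<open>\<open>T\<close> inverts the threshold: for positive \<open>l\<close>,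
        \<open>F x \<le> t l\<close> forces \<open>l \<le> T\<close>. The level integral is
        therefore again a power integral, and its power of \<open>F x\<close> combines with the
        square to the exponent \<open>q / (q - 1)\<close>.\<close>
      define T where "T = 2 * K * F x powr (- 1 / (q - 1))"
      have "?w l * ennreal ((F2 l x)\<^sup>2) \<le> ennreal ((F x)\<^sup>2) * (ennreal (l powr (q - 3)) * indicator {0<..T} l)" for l
      proof (cases "0 < l \<and> F x \<le> t l")
        case True
        then have "l / (2 * K) > 0" using K by simp
        then have "l / (2 * K) = t l powr (- 1 / (q - 1))"
        proof -
          have "- (q - 1) * (- 1 / (q - 1)) = 1" using q by (simp add: field_simps)
          then show ?thesis
            using \<open>l / (2 * K) > 0\<close> by (simp only: t_def powr_powr) (simp only: powr_one)
        qed
        also have "\<dots> \<le> F x powr (- 1 / (q - 1))"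
          using True pos q by (intro powr_mono2') auto
        finally have "l \<le> T" using K by (simp add: T_def field_simps)
        then show ?thesis using True by (simp add: F2_def mult.commute)
      qed (auto simp: F2_def)
      then have "(\<integral>\<^sup>+l. ?w l * ennreal ((F2 l x)\<^sup>2) \<partial>lborel)
        \<le> (\<integral>\<^sup>+l. ennreal ((F x)\<^sup>2) * (ennreal (l powr (q - 3)) * indicator {0<..T} l) \<partial>lborel)"
        by (intro nn_integral_mono)
      also have "\<dots> = ennreal ((F x)\<^sup>2) * ennreal (T powr (q - 2) / (q - 2))"
        using nn_integral_powr_Ioc[of "q - 3" T] q K by (simp add: nn_integral_cmult T_def)
      also have "\<dots> = ennreal ((2 * K) powr (q - 2) / (q - 2)) * ennreal (F x powr (q / (q - 1)))"
      proof -
        have "T powr (q - 2) = (2 * K) powr (q - 2) * F x powr (- 1 / (q - 1) * (q - 2))"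
          using K by (simp add: T_def powr_mult powr_powr)
        moreover have "(F x)\<^sup>2 * F x powr (- 1 / (q - 1) * (q - 2)) = F x powr (2 + (- 1 / (q - 1) * (q - 2)))"
          unfolding powr_add using pos by simp
        moreover have "2 + (- 1 / (q - 1) * (q - 2)) = q / (q - 1)"
          using q by (simp add: field_simps)
        ultimately have "(F x)\<^sup>2 * (T powr (q - 2) / (q - 2)) = (2 * K) powr (q - 2) / (q - 2) * F x powr (q / (q - 1))"
          by (simp add: mult_ac)
        then show ?thesis using q by (simp add: ennreal_mult'[symmetric] ennreal_mult''[symmetric])
      qed
      finally show ?thesis .
    qed (simp add: F2_def cong: if_cong)
  qed
  also have "\<dots> = ennreal ((2 * K) powr (q - 2) / (q - 2)) * (\<integral>\<^sup>+x. ennreal (F x powr (q / (q - 1))) \<partial>lborel)"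
    by (rule nn_integral_cmult) simp
  also have "\<dots> \<le> ennreal ((2 * K) powr (q - 2) / (q - 2)) * ennreal K"
    by (intro mult_left_mono FK) simp
  also have "ennreal (4 * (q - 2)) * (ennreal ((2 * K) powr (q - 2) / (q - 2)) * ennreal K)
      = ennreal (4 * (2 * K) powr (q - 2) * K)"
    using q K by (simp add: ennreal_mult''[symmetric] field_simps)
  finally show ?thesis
    by (simp add: mult_left_mono)
qed

text \<open>For \<open>q = 2\<close> the exponent \<open>q / (q - 1)\<close> is 2 and Plancherel
  suffices; this case stands apart because \<open>l powr (q - 3)\<close> is integrable near 0 only
  for \<open>q > 2\<close>. The form with a fixed bound \<open>K\<close> is not homogeneous; scaling
  is restored in \<open>fourier_image_bound\<close>.\<close>

lemma hausdorff_young: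
  fixes q K :: real
  assumes q: "q \<ge> 2" and K: "K > 0"
  obtains C where "C > 0" and
    "\<And>F :: 'a::euclidean_space \<Rightarrow> real. integrable lborel F \<Longrightarrow> (\<And>x. 0 \<le> F x) \<Longrightarrow>
      (\<integral>\<^sup>+x. ennreal (F x powr (q / (q - 1))) \<partial>lborel) \<le> ennreal K \<Longrightarrow>
      (\<integral>\<^sup>+\<xi>. ennreal (norm (fourier_measure (\<lambda>x. complex_of_real (F x)) lborel \<xi>) powr q) \<partial>lborel) \<le> ennreal C"
proof (cases "q = 2")
  case True
  have "(\<integral>\<^sup>+\<xi>. ennreal (norm (fourier_measure (\<lambda>x. complex_of_real (F x)) lborel \<xi>) powr q) \<partial>lborel) \<le> ennreal K"
    if F: "integrable lborel F" and "\<And>x. 0 \<le> F x" "(\<integral>\<^sup>+x. ennreal (F x powr (q / (q - 1))) \<partial>lborel) \<le> ennreal K"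
    for F :: "'a \<Rightarrow> real"
    using plancherel_le[OF F] that True by (auto simp: powr_numeral intro: order_trans)
  then show ?thesis using that K by blast
next
  case False
  then show ?thesis
    using that[of "4 * (2 * K) powr (q - 2) * K"] hausdorff_young_gt_2[of q K] q K by auto
qed

section \<open>Images of measures with a density\<close>

text \<open>The optimal choice is \<open>\<tau> = (H / g)\<^sup>1\<^sup>/\<^sup>p\<close>. Restricting to rational \<open>\<tau>\<close>, at the cost of
  the constant 3, leaves countably many almost-everywhere statements to combine.\<close>

lemma le_interpolated_of_le_split:
  fixes F g H p :: real
  assumes p: "p > 1" and nn: "0 \<le> F" "0 \<le> g" "0 \<le> H"
    and le: "\<And>\<tau>. \<tau> \<in> \<rat> \<Longrightarrow> 0 < \<tau> \<Longrightarrow> F \<le> \<tau> * g + \<tau> powr (1 - p) * H"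
  shows "F \<le> 3 * H powr (1 / p) * g powr (1 - 1 / p)"
proof -
  \<comment> \<open>A rational number between \<open>\<tau>\<close> and \<open>2 * \<tau>\<close>
    replaces \<open>\<tau>\<close>: the first term at most doubles, and the second does not grow
    because \<open>1 - p\<close> is negative.\<close>
  have le': "F \<le> 2 * \<tau> * g + \<tau> powr (1 - p) * H" if "\<tau> > 0" for \<tau>
  proof -
    obtain \<sigma> where \<sigma>: "\<sigma> \<in> \<rat>" "\<tau> < \<sigma>" "\<sigma> < 2 * \<tau>"
      using Rats_dense_in_real[of \<tau> "2 * \<tau>"] \<open>\<tau> > 0\<close> by auto
    have "F \<le> \<sigma> * g + \<sigma> powr (1 - p) * H"
      using le[of \<sigma>] \<sigma> that by simp
    also have "\<dots> \<le> 2 * \<tau> * g + \<tau> powr (1 - p) * H"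
      using \<sigma> that p nn by (intro add_mono mult_right_mono powr_mono2') auto
    finally show ?thesis .
  qed
  \<comment> \<open>If \<open>g\<close> or \<open>H\<close> vanishes, there need not be an optimal
    positive \<open>\<tau>\<close>. Then some \<open>\<tau>\<close> makes the right-hand side of
    \<open>le'\<close> at most \<open>F / 2\<close>, which contradicts \<open>F > 0\<close>.\<close>
  consider "F = 0" | "F > 0" "H = 0" | "F > 0" "H > 0" "g = 0" | "H > 0" "g > 0"
    using nn by linarith
  then show ?thesis
  proof cases
    case 2
    have "F \<le> 2 * (F / (4 * (g + 1))) * g"
      using le'[of "F / (4 * (g + 1))"] 2 nn by simp
    also have "\<dots> = F / 2 * (g / (g + 1))"
      using nn by (simp add: field_simps)
    also have "\<dots> \<le> F / 2 * 1"
      using nn 2 by (intro mult_left_mono) auto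
    finally show ?thesis using 2 by simp
  next
    case 3
    define \<tau> where "\<tau> = (F / (2 * H)) powr (1 / (1 - p))"
    have pos: "F / (2 * H) > 0" using 3 by simp
    then have "\<tau> > 0" using 3 by (simp add: \<tau>_def)
    moreover have "\<tau> powr (1 - p) = F / (2 * H)"
      using p 3 by (simp add: \<tau>_def powr_powr)
    ultimately have "F \<le> F / 2"
      using le'[of \<tau>] 3 by simp
    then show ?thesis using 3 by simp
  next
    case 4
    \<comment> \<open>This choice makes \<open>\<tau> * g\<close> and
      \<open>\<tau> powr (1 - p) * H\<close> equal to the same product of powers, so that
      \<open>le'\<close> yields the constant 2 + 1 = 3.\<close>
    define \<tau> where "\<tau> = (H / g) powr (1 / p)"
    have \<tau>: "\<tau> > 0" using 4 by (simp add: \<tau>_def)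
    have 1: "\<tau> * g = H powr (1 / p) * g powr (1 - 1 / p)"
      using 4 by (simp add: \<tau>_def powr_divide powr_diff)
    have "\<tau> powr (1 - p) * H = H powr (1 / p - 1) * g powr (1 - 1 / p) * H"
    proof -
      have "\<tau> powr (1 - p) = (H / g) powr (1 / p - 1)"
        using p by (simp add: \<tau>_def powr_powr right_diff_distrib)
      also have "\<dots> = H powr (1 / p - 1) * g powr (- (1 / p - 1))"
      proof -
        have "(H / g) powr c = H powr c * g powr (- c)" for c
          using 4 by (simp add: powr_divide powr_minus_divide)
        then show ?thesis .
      qed
      finally show ?thesis by simp
    qed
    also have "\<dots> = H powr (1 / p) * g powr (1 - 1 / p)"
      using 4 by (simp add: powr_diff)
    finally show ?thesis
      using le'[OF \<tau>] 1 by (simp add: algebra_simps)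
  qed (use nn in simp)
qed

text \<open>Where \<open>u\<close> exceeds \<open>\<tau>\<close>, multiplying it by
  \<open>(u / \<tau>) powr (p - 1)\<close>, which is at least 1, gives the second term. After
  passing to image densities the two terms become multiples of \<open>g\<close> and
  \<open>H\<close>.\<close>

lemma le_truncation_split:
  fixes u \<tau> p :: real
  assumes "p > 1" "0 \<le> u" "\<tau> > 0"
  shows "u \<le> \<tau> + \<tau> powr (1 - p) * u powr p"
proof (cases "u \<le> \<tau>")
  case False
  then have u: "u > 0" using assms by simp
  have "u * 1 \<le> u * (u / \<tau>) powr (p - 1)"
    using False assms u by (intro mult_left_mono ge_one_powr_ge_zero) auto
  also have "\<dots> = \<tau> powr (1 - p) * u powr p"
  proof -
    have "\<tau> powr (1 - p) = 1 / \<tau> powr (p - 1)"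
      using powr_minus_divide[of \<tau> "p - 1"] by simp
    moreover have "u * u powr (p - 1) = u powr p"
      using u by (simp add: powr_diff)
    ultimately show ?thesis
      using assms u by (simp add: powr_divide)
  qed
  finally show ?thesis using assms by simp
qed (use assms in \<open>simp add: add_increasing2\<close>)

text \<open>A measure \<open>P\<close> whose image under \<open>S\<close> has a density \<open>g\<close>; then so does every measure
  absolutely continuous with respect to \<open>P\<close>.\<close>

locale ac_image = finite_measure P for P :: "'z measure" +
  fixes S :: "'z \<Rightarrow> 'a::euclidean_space" and g :: "'a \<Rightarrow> real"
  assumes S_meas [measurable]: "S \<in> P \<rightarrow>\<^sub>M borel"
    and g_meas [measurable]: "g \<in> borel_measurable borel"
    and g_nonneg: "\<And>x. 0 \<le> g x"
    and distr_S: "distr P borel S = density lborel (\<lambda>x. ennreal (g x))"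
begin

text \<open>A relation and not a function, since a density is determined only up to null
  sets.\<close>

definition image_density :: "('z \<Rightarrow> real) \<Rightarrow> ('a \<Rightarrow> real) \<Rightarrow> bool" where
  "image_density u F \<longleftrightarrow> F \<in> borel_measurable borel \<and> (\<forall>x. 0 \<le> F x) \<and>
    distr (density P (\<lambda>z. ennreal (u z))) borel S = density lborel (\<lambda>x. ennreal (F x))"

text \<open>Radon-Nikodym: as the image of \<open>P\<close> has a density, the preimage of a
  Lebesgue null set is null for \<open>P\<close>, hence also for the measure with density
  \<open>u\<close>. Integrability of \<open>u\<close> makes the image finite, so the derivative has
  a real-valued version.\<close>

lemma image_density_exists:
  assumes u: "integrable P u"
  obtains F where "image_density u F"
proof -
  note [measurable] = borel_measurable_integrable[OF u]
  let ?N = "distr (density P (\<lambda>z. ennreal (u z))) borel S"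
  have ac: "absolutely_continuous lborel ?N"
    unfolding absolutely_continuous_def
  proof
    fix A :: "'a set" assume A: "A \<in> null_sets lborel"
    then have [measurable]: "A \<in> sets borel" by auto
    have "A \<in> null_sets (density lborel (\<lambda>x. ennreal (g x)))"
      using A absolutely_continuousI_density[of "\<lambda>x. ennreal (g x)" lborel]
      by (auto simp: absolutely_continuous_def)
    then have "A \<in> null_sets (distr P borel S)"
      by (simp add: distr_S)
    then have "S -` A \<inter> space P \<in> null_sets P"
      by (simp add: null_sets_distr_iff)
    then have "S -` A \<inter> space P \<in> null_sets (density P (\<lambda>z. ennreal (u z)))"
      using absolutely_continuousI_density[of "\<lambda>z. ennreal (u z)" P]
      by (auto simp: absolutely_continuous_def)
    then show "A \<in> null_sets ?N"
      by (simp add: null_sets_distr_iff)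
  qed
  have fin: "finite_measure ?N"
    using integrableD(2)[OF u]
    by (intro finite_measure.finite_measure_distr finite_measureI) (auto simp: emeasure_density cong: nn_integral_cong)
  obtain D where D: "D \<in> borel_measurable lborel" "AE x in lborel. RN_deriv lborel ?N x = ennreal (D x)" "\<And>x. 0 \<le> D x"
    using sigma_finite_measure.real_RN_deriv[OF sigma_finite_lborel fin ac] by auto
  have "?N = density lborel (RN_deriv lborel ?N)"
    using sigma_finite_measure.density_RN_deriv[OF sigma_finite_lborel ac] by simp
  also have "\<dots> = density lborel (\<lambda>x. ennreal (D x))"
    using D by (intro density_cong) auto
  finally show ?thesis
    using that[of D] D by (simp add: image_density_def)
qed

lemma image_densityD:
  assumes "image_density u F"
  shows "F \<in> borel_measurable borel" "0 \<le> F x"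
  using assms by (auto simp: image_density_def)

lemma nn_integral_image_density:
  assumes F: "image_density u F" and [measurable]: "u \<in> borel_measurable P" "\<phi> \<in> borel_measurable borel"
  shows "(\<integral>\<^sup>+x. ennreal (F x) * \<phi> x \<partial>lborel) = (\<integral>\<^sup>+z. ennreal (u z) * \<phi> (S z) \<partial>P)"
proof -
  note [measurable] = image_densityD(1)[OF F]
  have "(\<integral>\<^sup>+x. ennreal (F x) * \<phi> x \<partial>lborel) = (\<integral>\<^sup>+x. \<phi> x \<partial>density lborel (\<lambda>x. ennreal (F x)))"
    by (simp add: nn_integral_density)
  also have "\<dots> = (\<integral>\<^sup>+x. \<phi> x \<partial>distr (density P (\<lambda>z. ennreal (u z))) borel S)"
    using F by (simp add: image_density_def)
  also have "\<dots> = (\<integral>\<^sup>+z. ennreal (u z) * \<phi> (S z) \<partial>P)"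
    by (simp add: nn_integral_distr nn_integral_density)
  finally show ?thesis .
qed

lemma image_density_integrable:
  assumes F: "image_density u F" and u: "integrable P u"
  shows "integrable lborel F"
proof -
  note [measurable] = image_densityD(1)[OF F] borel_measurable_integrable[OF u]
  have "(\<integral>\<^sup>+x. ennreal (F x) \<partial>lborel) = (\<integral>\<^sup>+z. ennreal (u z) \<partial>P)"
    using nn_integral_image_density[OF F, of "\<lambda>_. 1"] by simp
  then show ?thesis
    using integrableD(2)[OF u] image_densityD(2)[OF F]
    by (intro integrableI_nonneg) (auto simp: less_top)
qed

lemma fourier_image_density:
  assumes F: "image_density u F" and [measurable]: "u \<in> borel_measurable P" and nn: "\<And>z. 0 \<le> u z"
  shows "fourier_measure (\<lambda>x. complex_of_real (F x)) lborel \<xi> = (\<integral>z. complex_of_real (u z) * wave (S z) \<xi> \<partial>P)"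
proof -
  note [measurable] = image_densityD(1)[OF F]
  have "fourier_measure (\<lambda>x. complex_of_real (F x)) lborel \<xi> = (\<integral>x. wave x \<xi> \<partial>density lborel (\<lambda>x. ennreal (F x)))"
    using image_densityD(2)[OF F]
    by (subst integral_density) (auto simp: fourier_measure_wave scaleR_conv_of_real)
  also have "\<dots> = (\<integral>x. wave x \<xi> \<partial>distr (density P (\<lambda>z. ennreal (u z))) borel S)"
    using F by (simp add: image_density_def)
  also have "\<dots> = (\<integral>z. wave (S z) \<xi> \<partial>density P (\<lambda>z. ennreal (u z)))"
    by (rule integral_distr) auto
  also have "\<dots> = (\<integral>z. complex_of_real (u z) * wave (S z) \<xi> \<partial>P)"
    by (subst integral_density) (auto simp: scaleR_conv_of_real nn)
  finally show ?thesis .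
qed

lemma image_density_const: "image_density (\<lambda>_. 1) g"
  using g_nonneg by (simp add: image_density_def density_1 distr_S)

text \<open>The slack \<open>a + b * v z - u z\<close> is nonnegative and has an image density
  \<open>E\<close> of its own. By linearity \<open>F + E\<close> and \<open>a * g + b * H\<close>
  are densities of one measure, so they agree almost everywhere, and \<open>E\<close> is
  nonnegative.\<close>

lemma image_density_le:
  assumes F: "image_density u F" and H: "image_density v H" and int: "integrable P u" "integrable P v"
    and nn: "\<And>z. 0 \<le> u z" "\<And>z. 0 \<le> v z" and ab: "0 \<le> a" "0 \<le> b"
    and le: "\<And>z. u z \<le> a + b * v z"
  shows "AE x in lborel. F x \<le> a * g x + b * H x"
proof -
  have "integrable P (\<lambda>z. a + b * v z - u z)"
    using int by simp
  then obtain E where E: "image_density (\<lambda>z. a + b * v z - u z) E"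
    using image_density_exists by blast
  note [measurable] = image_densityD(1)[OF F] image_densityD(1)[OF H] image_densityD(1)[OF E]
    borel_measurable_integrable[OF int(1)] borel_measurable_integrable[OF int(2)]
  note nonneg = image_densityD(2)[OF F] image_densityD(2)[OF H] image_densityD(2)[OF E] g_nonneg
  have "density lborel (\<lambda>x. ennreal (F x + E x)) = density lborel (\<lambda>x. ennreal (a * g x + b * H x))"
  proof (rule measure_eqI)
    fix A :: "'a set" assume "A \<in> sets (density lborel (\<lambda>x. ennreal (F x + E x)))"
    then have [measurable]: "A \<in> sets borel" by simp
    have "emeasure (density lborel (\<lambda>x. ennreal (F x + E x))) A
      = (\<integral>\<^sup>+x. ennreal (F x) * indicator A x + ennreal (E x) * indicator A x \<partial>lborel)"
      using nonneg by (simp add: emeasure_density distrib_right)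
    also have "\<dots> = (\<integral>\<^sup>+z. ennreal (u z) * indicator A (S z) \<partial>P) + (\<integral>\<^sup>+z. ennreal (a + b * v z - u z) * indicator A (S z) \<partial>P)"
      by (simp add: nn_integral_add nn_integral_image_density[OF F] nn_integral_image_density[OF E])
    also have "\<dots> = (\<integral>\<^sup>+z. ennreal (a + b * v z) * indicator A (S z) \<partial>P)"
      using nn le ab
      by (subst nn_integral_add[symmetric]) (auto simp flip: distrib_right ennreal_plus)
    also have "\<dots> = (\<integral>\<^sup>+z. ennreal a * (ennreal 1 * indicator A (S z)) + ennreal b * (ennreal (v z) * indicator A (S z)) \<partial>P)"
      using nn ab by (simp add: ennreal_mult' distrib_right mult.assoc)
    also have "\<dots> = ennreal a * (\<integral>\<^sup>+x. ennreal (g x) * indicator A x \<partial>lborel) + ennreal b * (\<integral>\<^sup>+x. ennreal (H x) * indicator A x \<partial>lborel)"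
      using nn_integral_image_density[OF image_density_const, of "indicator A"]
      by (simp add: nn_integral_add nn_integral_cmult nn_integral_image_density[OF H])
    also have "\<dots> = (\<integral>\<^sup>+x. ennreal (a * g x + b * H x) * indicator A x \<partial>lborel)"
      using nonneg ab
      by (subst (1 2) nn_integral_cmult[symmetric], simp, simp, simp, subst nn_integral_add[symmetric])
         (auto simp: ennreal_mult' distrib_right mult.assoc)
    also have "\<dots> = emeasure (density lborel (\<lambda>x. ennreal (a * g x + b * H x))) A"
      by (simp add: emeasure_density)
    finally show "emeasure (density lborel (\<lambda>x. ennreal (F x + E x))) A
      = emeasure (density lborel (\<lambda>x. ennreal (a * g x + b * H x))) A" .
  qed simp
  then have "AE x in lborel. ennreal (F x + E x) = ennreal (a * g x + b * H x)"
    by (intro sigma_finite_measure.density_unique[OF sigma_finite_lborel]) auto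
  then show ?thesis
  proof eventually_elim
    case (elim x)
    then have "F x + E x = a * g x + b * H x"
      using nonneg ab by (subst (asm) ennreal_inj) auto
    then show ?case using nonneg(3)[of x] by simp
  qed
qed

text \<open>This takes the place of Hoelder's inequality on the fibres of \<open>S\<close>, without
  disintegrating \<open>P\<close>: the split of \<open>u\<close> at each height passes to the
  densities, and the height is optimised pointwise afterwards.\<close>

lemma image_density_interpolate:
  assumes F: "image_density u F" and H: "image_density (\<lambda>z. u z powr p) H" and p: "p > 1"
    and int: "integrable P u" "integrable P (\<lambda>z. u z powr p)" and nn: "\<And>z. 0 \<le> u z"
  shows "AE x in lborel. F x \<le> 3 * H x powr (1 / p) * g x powr (1 - 1 / p)"
proof -
  have "AE x in lborel. F x \<le> \<tau> * g x + \<tau> powr (1 - p) * H x" if "\<tau> > 0" for \<tau>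
    using that by (intro image_density_le[OF F H int nn] le_truncation_split p nn) auto
  then have "AE x in lborel. \<forall>\<tau>\<in>{\<tau> \<in> \<rat>. 0 < \<tau>}. F x \<le> \<tau> * g x + \<tau> powr (1 - p) * H x"
    by (subst AE_ball_countable) (auto intro: countable_subset[OF _ countable_rat])
  then show ?thesis
    by eventually_elim
       (rule le_interpolated_of_le_split[OF p], auto simp: image_densityD[OF F] image_densityD[OF H] g_nonneg)
qed

end

section \<open>Exponents and the \<open>Lp_norm\<close>\<close>

text \<open>A crude form of Young's inequality: the maximum replaces both bases.\<close>

lemma powr_mult_powr_le_add:
  fixes x y a :: real
  assumes "0 \<le> x" "0 \<le> y" "0 \<le> a" "a \<le> 1"
  shows "x powr a * y powr (1 - a) \<le> x + y"
proof -
  have "x powr a * y powr (1 - a) \<le> max x y powr a * max x y powr (1 - a)"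
    using assms by (intro mult_mono powr_mono2) auto
  also have "\<dots> = max x y"
    using assms by (simp flip: powr_add)
  finally show ?thesis using assms by simp
qed

text \<open>Here \<open>r\<close> is the conjugate exponent of \<open>q\<close>. The last identity
  says that the power \<open>r\<close> of \<open>H powr (1 / p) * g powr (1 - 1 / p)\<close> is a
  weighted geometric mean of \<open>H\<close> and \<open>g powr s\<close>, with weights
  \<open>r / p\<close> and \<open>1 - r / p\<close>. This is where the exponent \<open>s\<close> of
  the convolution comes from.\<close>

lemma convolution_exponent_interpolation:
  fixes p q :: real
  assumes p: "p > 1" and q: "q > p / (p - 1)"
  defines "s \<equiv> q * (p - 1) / (q * (p - 1) - p)" and "r \<equiv> q / (q - 1)"
  shows "q * (p - 1) - p > 0" "0 < r" "r < p" "s > 0" "(1 - 1 / p) * r = s * (1 - r / p)"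
proof -
  show 1: "q * (p - 1) - p > 0"
    using p q by (simp add: field_simps)
  have "p / (p - 1) > 1" using p by (simp add: field_simps)
  then have q1: "q > 1" using q by linarith
  show 2: "0 < r" using q1 by (simp add: r_def)
  show "r < p" using q1 1 by (simp add: r_def field_simps)
  show "s > 0" using 1 p q1 by (simp add: s_def)
  have "1 - r / p = (q * (p - 1) - p) / (p * (q - 1))"
    using p q1 by (simp add: r_def field_simps)
  then have "s * (1 - r / p) = q * (p - 1) / (p * (q - 1))"
    using 1 by (simp add: s_def)
  also have "\<dots> = (1 - 1 / p) * r"
    using p q1 by (simp add: r_def field_simps)
  finally show "(1 - 1 / p) * r = s * (1 - r / p)" by simp
qed

lemma Lp_norm_le:
  assumes "q > 0" "0 \<le> B" and le: "(\<integral>\<^sup>+x. ennreal (norm (f x) powr q) \<partial>M) \<le> ennreal (B powr q)"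
  shows "Lp_norm (ennreal q) M f \<le> ennreal B"
proof -
  let ?I = "\<integral>\<^sup>+x. ennreal (norm (f x) powr q) \<partial>M"
  have fin: "?I \<noteq> \<infinity>" using le by (auto simp: top_unique)
  have "enn2real ?I \<le> B powr q"
    using le by (rule enn2real_leI[rotated]) simp
  then have "enn2real ?I powr (1 / q) \<le> (B powr q) powr (1 / q)"
    using assms by (intro powr_mono2) auto
  then show ?thesis
    using assms fin by (simp add: Lp_norm_def Let_def powr_powr ennreal_leI)
qed

lemma Lp_norm_finiteE:
  assumes "q > 0" and "Lp_norm (ennreal q) M f < \<infinity>"
  obtains B where "0 \<le> B" "Lp_norm (ennreal q) M f = ennreal B"
    "(\<integral>\<^sup>+x. ennreal (norm (f x) powr q) \<partial>M) = ennreal (B powr q)"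
proof -
  let ?I = "\<integral>\<^sup>+x. ennreal (norm (f x) powr q) \<partial>M"
  have fin: "?I \<noteq> \<infinity>"
    using assms by (auto simp: Lp_norm_def Let_def split: if_splits)
  show ?thesis
  proof (rule that[of "enn2real ?I powr (1 / q)"])
    show "Lp_norm (ennreal q) M f = ennreal (enn2real ?I powr (1 / q))"
      using assms fin by (simp add: Lp_norm_def Let_def)
    show "?I = ennreal ((enn2real ?I powr (1 / q)) powr q)"
      using assms fin by (simp add: powr_powr less_top)
  qed simp
qed

section \<open>The Fourier transform of image measures\<close>

context ac_image
begin

text \<open>The density \<open>H\<close> has integral at most 1 by the normalisation of
  \<open>u\<close>. In the endpoint case \<open>q\<close> is conjugate to \<open>p\<close>,
  \<open>g\<close> is essentially bounded and the \<open>p\<close>-th power of \<open>F\<close> is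
  at most a multiple of \<open>H\<close>; otherwise the power of \<open>F\<close> is at most a
  multiple of \<open>H + g powr s\<close>.\<close>

lemma image_density_powr_bound:
  assumes p: "p > 1" and q: "q \<ge> p / (p - 1)"
    and g: "g \<in> Lp_space (convolution_exponent p q) lborel"
  obtains K where "K > 0" and
    "\<And>u F H. image_density u F \<Longrightarrow> image_density (\<lambda>z. u z powr p) H \<Longrightarrow> integrable P u \<Longrightarrow>
       integrable P (\<lambda>z. u z powr p) \<Longrightarrow> (\<And>z. 0 \<le> u z) \<Longrightarrow> (\<integral>\<^sup>+z. ennreal (u z powr p) \<partial>P) \<le> 1 \<Longrightarrow>
       (\<integral>\<^sup>+x. ennreal (F x powr (q / (q - 1))) \<partial>lborel) \<le> ennreal K"
proof -
  define r where "r = q / (q - 1)"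
  have "p / (p - 1) > 1" using p by (simp add: field_simps)
  then have q1: "q > 1" using q by linarith
  have r: "r > 0" using q1 by (simp add: r_def)
  have Hint: "(\<integral>\<^sup>+x. ennreal (H x) \<partial>lborel) \<le> 1"
    if "image_density (\<lambda>z. u z powr p) H" "integrable P (\<lambda>z. u z powr p)" "(\<integral>\<^sup>+z. ennreal (u z powr p) \<partial>P) \<le> 1" for u H
    using nn_integral_image_density[OF that(1), of "\<lambda>_. 1"] borel_measurable_integrable[OF that(2)] that(3) by simp
  show ?thesis
  proof (cases "q * (p - 1) - p = 0")
    case True
    have pq: "r = p"
      using True p q1 by (simp add: r_def field_simps)
    have "esssup lborel (\<lambda>x. ennreal (norm (g x))) < \<infinity>"
      using g True by (simp add: Lp_space_def Lp_norm_def convolution_exponent_def)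
    then obtain M where M: "esssup lborel (\<lambda>x. ennreal (norm (g x))) = ennreal M" "0 \<le> M"
      by (cases "esssup lborel (\<lambda>x. ennreal (norm (g x)))") auto
    have gM: "AE x in lborel. g x \<le> M"
      using esssup_AE[of "\<lambda>x. ennreal (norm (g x))" lborel]
      by eventually_elim (use M g_nonneg in auto)
    \<comment> \<open>The added 1 keeps the constant positive when \<open>M\<close> is 0.\<close>
    show ?thesis
    proof (rule that[of "3 powr p * (M powr (p - 1) + 1)"], goal_cases)
      case (2 u F H)
      note [measurable] = image_densityD(1)[OF 2(1)] image_densityD(1)[OF 2(2)]
      note nonneg = image_densityD(2)[OF 2(1)] image_densityD(2)[OF 2(2)] g_nonneg
      have "AE x in lborel. F x powr r \<le> 3 powr p * M powr (p - 1) * H x"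
        using image_density_interpolate[OF 2(1,2) p 2(3-5)] gM
      proof eventually_elim
        case (elim x)
        have "F x powr r \<le> (3 * H x powr (1 / p) * g x powr (1 - 1 / p)) powr p"
          unfolding pq using elim p nonneg by (intro powr_mono2) auto
        also have "\<dots> = 3 powr p * H x * g x powr (p - 1)"
          using p nonneg by (simp add: powr_mult powr_powr left_diff_distrib)
        also have "\<dots> \<le> 3 powr p * H x * M powr (p - 1)"
          using elim p nonneg by (intro mult_left_mono powr_mono2) auto
        finally show ?case by (simp add: mult_ac)
      qed
      then have "(\<integral>\<^sup>+x. ennreal (F x powr r) \<partial>lborel) \<le> (\<integral>\<^sup>+x. ennreal (3 powr p * M powr (p - 1)) * ennreal (H x) \<partial>lborel)"
        by (intro nn_integral_mono_AE) (auto elim!: eventually_mono simp: ennreal_mult'[symmetric] intro!: ennreal_leI)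
      also have "\<dots> = ennreal (3 powr p * M powr (p - 1)) * (\<integral>\<^sup>+x. ennreal (H x) \<partial>lborel)"
        by (rule nn_integral_cmult) simp
      also have "\<dots> \<le> ennreal (3 powr p * M powr (p - 1)) * 1"
        by (intro mult_left_mono Hint[OF 2(2,4,6)]) simp
      also have "\<dots> \<le> ennreal (3 powr p * (M powr (p - 1) + 1))"
        by (auto intro!: ennreal_leI)
      finally show ?case by (simp add: r_def)
    qed (auto intro!: mult_pos_pos add_nonneg_pos)
  next
    case False
    then have qp: "q > p / (p - 1)" using q p by (auto simp: field_simps less_le)
    define s where "s = q * (p - 1) / (q * (p - 1) - p)"
    note ex = convolution_exponent_interpolation[OF p qp, folded s_def r_def]
    have gs: "(\<integral>\<^sup>+x. ennreal (g x powr s) \<partial>lborel) \<noteq> \<infinity>"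
      using g False ex g_nonneg
      by (auto simp: Lp_space_def Lp_norm_def convolution_exponent_def Let_def s_def[symmetric] split: if_splits)
    then obtain M where M: "(\<integral>\<^sup>+x. ennreal (g x powr s) \<partial>lborel) = ennreal M" "0 \<le> M"
      by (cases "\<integral>\<^sup>+x. ennreal (g x powr s) \<partial>lborel") auto
    show ?thesis
    proof (rule that[of "3 powr r * (1 + M)"], goal_cases)
      case (2 u F H)
      note [measurable] = image_densityD(1)[OF 2(1)] image_densityD(1)[OF 2(2)]
      note nonneg = image_densityD(2)[OF 2(1)] image_densityD(2)[OF 2(2)] g_nonneg
      have "AE x in lborel. F x powr r \<le> 3 powr r * (H x + g x powr s)"
        using image_density_interpolate[OF 2(1,2) p 2(3-5)]
      proof eventually_elim
        case (elim x)
        have "F x powr r \<le> (3 * H x powr (1 / p) * g x powr (1 - 1 / p)) powr r"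
          using elim r nonneg by (intro powr_mono2) auto
        also have "\<dots> = 3 powr r * (H x powr (r / p) * (g x powr s) powr (1 - r / p))"
          using p nonneg by (simp add: powr_mult powr_powr ex(5))
        also have "\<dots> \<le> 3 powr r * (H x + g x powr s)"
          using ex p nonneg by (intro mult_left_mono powr_mult_powr_le_add) auto
        finally show ?case .
      qed
      then have "(\<integral>\<^sup>+x. ennreal (F x powr r) \<partial>lborel) \<le> (\<integral>\<^sup>+x. ennreal (3 powr r) * (ennreal (H x) + ennreal (g x powr s)) \<partial>lborel)"
        using nonneg
        by (intro nn_integral_mono_AE) (auto elim!: eventually_mono simp: ennreal_mult'[symmetric] simp flip: ennreal_plus intro!: ennreal_leI)
      also have "\<dots> = ennreal (3 powr r) * ((\<integral>\<^sup>+x. ennreal (H x) \<partial>lborel) + ennreal M)"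
        by (simp add: nn_integral_cmult nn_integral_add M)
      also have "\<dots> \<le> ennreal (3 powr r) * (1 + ennreal M)"
        by (intro mult_left_mono add_right_mono Hint[OF 2(2,4,6)]) simp
      also have "\<dots> = ennreal (3 powr r * (1 + M))"
        using M by (simp add: ennreal_mult')
      finally show ?case by (simp add: r_def)
    qed (use M in \<open>auto intro!: mult_pos_pos\<close>)
  qed
qed

text \<open>The bound on the power of the image density \<open>F\<close> is the input of
  Hausdorff-Young, and the transform of \<open>F\<close> is the integral over \<open>P\<close>.
  Integrability of \<open>u\<close> is part of the conclusion because
  \<open>fourier_image_bound_unit\<close> has to split an integral into four.\<close>

lemma fourier_image_bound_nonneg:
  assumes p: "p > 1" and q: "q \<ge> 2" "q \<ge> p / (p - 1)"
    and g: "g \<in> Lp_space (convolution_exponent p q) lborel"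
  obtains C where "C > 0" and
    "\<And>u. u \<in> borel_measurable P \<Longrightarrow> (\<And>z. 0 \<le> u z) \<Longrightarrow> (\<integral>\<^sup>+z. ennreal (u z powr p) \<partial>P) \<le> 1 \<Longrightarrow>
       integrable P u \<and>
       (\<integral>\<^sup>+\<xi>. ennreal (norm (\<integral>z. complex_of_real (u z) * wave (S z) \<xi> \<partial>P) powr q) \<partial>lborel) \<le> ennreal C"
proof -
  obtain K where K: "K > 0" and KF: "\<And>u F H. image_density u F \<Longrightarrow> image_density (\<lambda>z. u z powr p) H \<Longrightarrow> integrable P u \<Longrightarrow>
       integrable P (\<lambda>z. u z powr p) \<Longrightarrow> (\<And>z. 0 \<le> u z) \<Longrightarrow> (\<integral>\<^sup>+z. ennreal (u z powr p) \<partial>P) \<le> 1 \<Longrightarrow>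
       (\<integral>\<^sup>+x. ennreal (F x powr (q / (q - 1))) \<partial>lborel) \<le> ennreal K"
  proof (rule image_density_powr_bound[OF p q(2) g], goal_cases)
    case (1 C)
    from 1(2,3) show ?case by (rule 1(1))
  qed
  obtain C where C: "C > 0" "\<And>F :: 'a \<Rightarrow> real. integrable lborel F \<Longrightarrow> (\<And>x. 0 \<le> F x) \<Longrightarrow>
      (\<integral>\<^sup>+x. ennreal (F x powr (q / (q - 1))) \<partial>lborel) \<le> ennreal K \<Longrightarrow>
      (\<integral>\<^sup>+\<xi>. ennreal (norm (fourier_measure (\<lambda>x. complex_of_real (F x)) lborel \<xi>) powr q) \<partial>lborel) \<le> ennreal C"
  proof (rule hausdorff_young[OF q(1) K, where 'a='a], goal_cases)
    case (1 C)
    from 1(2,3) show ?case by (rule 1(1))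
  qed
  show ?thesis
  proof (rule that[OF C(1)])
    fix u assume u[measurable]: "u \<in> borel_measurable P" and nn: "\<And>z. 0 \<le> u z" and le: "(\<integral>\<^sup>+z. ennreal (u z powr p) \<partial>P) \<le> 1"
    have intp: "integrable P (\<lambda>z. u z powr p)"
      using le by (intro integrableI_nonneg) (auto intro: order_le_less_trans)
    \<comment> \<open>Truncation at height 1 bounds \<open>u\<close> by \<open>1 + u powr p\<close>,
      and constants are integrable because \<open>P\<close> is finite.\<close>
    have int: "integrable P u"
    proof (rule Bochner_Integration.integrable_bound)
      show "integrable P (\<lambda>z. 1 + u z powr p)" using intp by simp
      show "AE z in P. norm (u z) \<le> norm (1 + u z powr p)"
        using le_truncation_split[OF p nn, of 1] nn by auto
    qed simp
    obtain F H where F: "image_density u F" and H: "image_density (\<lambda>z. u z powr p) H"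
      using image_density_exists[OF int] image_density_exists[OF intp] by metis
    have "(\<integral>\<^sup>+\<xi>. ennreal (norm (fourier_measure (\<lambda>x. complex_of_real (F x)) lborel \<xi>) powr q) \<partial>lborel) \<le> ennreal C"
      by (intro C(2) image_density_integrable[OF F int] image_densityD(2)[OF F] KF[OF F H int intp nn le])
    then show "integrable P u \<and>
       (\<integral>\<^sup>+\<xi>. ennreal (norm (\<integral>z. complex_of_real (u z) * wave (S z) \<xi> \<partial>P) powr q) \<partial>lborel) \<le> ennreal C"
      using int by (simp add: fourier_image_density[OF F u nn])
  qed
qed

text \<open>A complex \<open>U\<close> is split into the positive and negative parts of its real and
  imaginary parts. Each is dominated by \<open>norm (U z)\<close> and so inherits the
  normalisation.\<close>

lemma fourier_image_bound_unit:
  assumes p: "p > 1" and q: "q \<ge> 2" "q \<ge> p / (p - 1)"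
    and g: "g \<in> Lp_space (convolution_exponent p q) lborel"
  obtains C where "C > 0" and
    "\<And>U :: 'z \<Rightarrow> complex. U \<in> borel_measurable P \<Longrightarrow> (\<integral>\<^sup>+z. ennreal (norm (U z) powr p) \<partial>P) \<le> 1 \<Longrightarrow>
       (\<integral>\<^sup>+\<xi>. ennreal (norm (\<integral>z. U z * wave (S z) \<xi> \<partial>P) powr q) \<partial>lborel) \<le> ennreal C"
proof -
  obtain C where C: "C > 0" and Cu:
    "\<And>u. u \<in> borel_measurable P \<Longrightarrow> (\<And>z. 0 \<le> u z) \<Longrightarrow> (\<integral>\<^sup>+z. ennreal (u z powr p) \<partial>P) \<le> 1 \<Longrightarrow>
       integrable P u \<and>
       (\<integral>\<^sup>+\<xi>. ennreal (norm (\<integral>z. complex_of_real (u z) * wave (S z) \<xi> \<partial>P) powr q) \<partial>lborel) \<le> ennreal C"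
  proof (rule fourier_image_bound_nonneg[OF assms], goal_cases)
    case (1 C)
    from 1(2,3) show ?case by (rule 1(1))
  qed
  \<comment> \<open>A sum of four terms is at most 4 times the largest in norm, whence
    \<open>4 powr q\<close>. The power of the largest is at most the sum of the four powers, whence
    \<open>4 * C\<close>.\<close>
  show ?thesis
  proof (rule that[of "4 powr q * (4 * C)"])
    fix U :: "'z \<Rightarrow> complex"
    assume U[measurable]: "U \<in> borel_measurable P" and le: "(\<integral>\<^sup>+z. ennreal (norm (U z) powr p) \<partial>P) \<le> 1"
    define u where "u j z = (if j = 0 then max 0 (Re (U z)) else if j = 1 then max 0 (- Re (U z))
       else if j = 2 then max 0 (Im (U z)) else max 0 (- Im (U z)))" for j :: nat and z
    define c where "c j = (if j = 0 then 1 else if j = 1 then -1 else if j = 2 then \<i> else -\<i>)" for j :: nat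
    have u[measurable]: "u j \<in> borel_measurable P" and unn: "0 \<le> u j z" and uU: "u j z \<le> norm (U z)" for j z
      using abs_Re_le_cmod[of "U z"] abs_Im_le_cmod[of "U z"] by (auto simp: u_def[abs_def])
    have ule: "(\<integral>\<^sup>+z. ennreal (u j z powr p) \<partial>P) \<le> 1" for j
      using uU unn p by (intro order_trans[OF nn_integral_mono le]) (auto intro!: ennreal_leI powr_mono2)
    define A where "A j \<xi> = (\<integral>z. complex_of_real (u j z) * wave (S z) \<xi> \<partial>P)" for j \<xi>
    have [measurable]: "A j \<in> borel_measurable borel" for j
      unfolding A_def by measurable
    have int: "integrable P (\<lambda>z. complex_of_real (u j z) * wave (S z) \<xi>)" for j \<xi>
      by (rule Bochner_Integration.integrable_bound[OF conjunct1[OF Cu[OF u unn ule, of j]]])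
        (auto simp: norm_mult)
    have "U z = (\<Sum>j<4. c j * complex_of_real (u j z))" for z
      by (simp add: c_def u_def eval_nat_numeral complex_eq_iff max_def)
    then have "(\<integral>z. U z * wave (S z) \<xi> \<partial>P) = (\<integral>z. (\<Sum>j<4. c j * (complex_of_real (u j z) * wave (S z) \<xi>)) \<partial>P)" for \<xi>
      by (simp add: sum_distrib_right mult.assoc)
    also have "\<dots> \<xi> = (\<Sum>j<4. c j * A j \<xi>)" for \<xi>
      using int by (simp add: A_def)
    finally have eq: "(\<integral>z. U z * wave (S z) \<xi> \<partial>P) = (\<Sum>j<4. c j * A j \<xi>)" for \<xi> .
    have pt: "norm (\<integral>z. U z * wave (S z) \<xi> \<partial>P) powr q \<le> 4 powr q * (\<Sum>j<4. norm (A j \<xi>) powr q)" for \<xi>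
    proof -
      define m where "m = Max ((\<lambda>j. norm (A j \<xi>)) ` {..<4::nat})"
      have "m \<in> (\<lambda>j. norm (A j \<xi>)) ` {..<4}"
        unfolding m_def by (rule Max_in) (auto simp: lessThan_empty_iff)
      moreover have "norm (A j \<xi>) \<le> m" if "j < 4" for j
        unfolding m_def using that by (intro Max_ge) auto
      ultimately obtain i where i: "i < 4" "\<And>j. j < 4 \<Longrightarrow> norm (A j \<xi>) \<le> norm (A i \<xi>)"
        by auto
      have "norm (\<Sum>j<4. c j * A j \<xi>) \<le> (\<Sum>j<4::nat. norm (A i \<xi>))"
        by (rule order_trans[OF norm_sum sum_mono]) (auto simp: norm_mult c_def i)
      then have "norm (\<Sum>j<4. c j * A j \<xi>) powr q \<le> (4 * norm (A i \<xi>)) powr q"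
        using q by (intro powr_mono2) auto
      also have "\<dots> = 4 powr q * norm (A i \<xi>) powr q" by (simp add: powr_mult)
      also have "\<dots> \<le> 4 powr q * (\<Sum>j<4. norm (A j \<xi>) powr q)"
        using i by (intro mult_left_mono member_le_sum) auto
      finally show ?thesis by (simp add: eq)
    qed
    have "(\<integral>\<^sup>+\<xi>. ennreal (norm (\<integral>z. U z * wave (S z) \<xi> \<partial>P) powr q) \<partial>lborel)
      \<le> (\<integral>\<^sup>+\<xi>. ennreal (4 powr q) * (\<Sum>j<4::nat. ennreal (norm (A j \<xi>) powr q)) \<partial>lborel)"
      by (intro nn_integral_mono order_trans[OF ennreal_leI[OF pt]]) (simp add: ennreal_mult' sum_ennreal)
    also have "\<dots> = ennreal (4 powr q) * (\<Sum>j<4::nat. \<integral>\<^sup>+\<xi>. ennreal (norm (A j \<xi>) powr q) \<partial>lborel)"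
      by (subst nn_integral_cmult) (simp_all add: nn_integral_sum del: sum_ennreal)
    also have "\<dots> \<le> ennreal (4 powr q) * (\<Sum>j<4::nat. ennreal C)"
      unfolding A_def by (intro mult_left_mono sum_mono conjunct2[OF Cu[OF u unn ule]]) simp
    also have "\<dots> = ennreal (4 powr q * (4 * C))"
      using C by (simp add: ennreal_mult')
    finally show "(\<integral>\<^sup>+\<xi>. ennreal (norm (\<integral>z. U z * wave (S z) \<xi> \<partial>P) powr q) \<partial>lborel) \<le> ennreal (4 powr q * (4 * C))" .
  qed (use C in auto)
qed

text \<open>Homogeneity: \<open>U\<close> is divided by its norm \<open>B\<close>. If
  \<open>B\<close> is 0, then \<open>U\<close> vanishes almost everywhere and so does every integral
  against it.\<close>

lemma fourier_image_bound:
  assumes p: "p > 1" and q: "q \<ge> 2" "q \<ge> p / (p - 1)"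
    and g: "g \<in> Lp_space (convolution_exponent p q) lborel"
  obtains C where "C > 0" and
    "\<And>U :: 'z \<Rightarrow> complex. U \<in> borel_measurable P \<Longrightarrow> Lp_norm (ennreal p) P U < \<infinity> \<Longrightarrow>
       Lp_norm (ennreal q) lborel (\<lambda>\<xi>. \<integral>z. U z * wave (S z) \<xi> \<partial>P) \<le> ennreal C * Lp_norm (ennreal p) P U"
proof -
  obtain C where C: "C > 0" and CU:
    "\<And>U :: 'z \<Rightarrow> complex. U \<in> borel_measurable P \<Longrightarrow> (\<integral>\<^sup>+z. ennreal (norm (U z) powr p) \<partial>P) \<le> 1 \<Longrightarrow>
       (\<integral>\<^sup>+\<xi>. ennreal (norm (\<integral>z. U z * wave (S z) \<xi> \<partial>P) powr q) \<partial>lborel) \<le> ennreal C"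
  proof (rule fourier_image_bound_unit[OF assms], goal_cases)
    case (1 C)
    from 1(2,3) show ?case by (rule 1(1))
  qed
  show ?thesis
  proof (rule that[of "C powr (1 / q)"])
    fix U :: "'z \<Rightarrow> complex"
    assume U[measurable]: "U \<in> borel_measurable P" and fin: "Lp_norm (ennreal p) P U < \<infinity>"
    obtain B where B: "0 \<le> B" "Lp_norm (ennreal p) P U = ennreal B"
      "(\<integral>\<^sup>+z. ennreal (norm (U z) powr p) \<partial>P) = ennreal (B powr p)"
      using Lp_norm_finiteE[OF _ fin] p by auto
    let ?A = "\<lambda>U \<xi>. \<integral>z. U z * wave (S z) \<xi> \<partial>P"
    have "(\<integral>\<^sup>+\<xi>. ennreal (norm (?A U \<xi>) powr q) \<partial>lborel) \<le> ennreal ((C powr (1 / q) * B) powr q)"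
    proof (cases "B = 0")
      case True
      then have "AE z in P. U z = 0"
        using B(3) by (simp add: nn_integral_0_iff_AE)
      then have "?A U \<xi> = 0" for \<xi>
        by (intro integral_eq_zero_AE) (auto elim: eventually_mono)
      then show ?thesis by simp
    next
      case False
      then have B0: "B > 0" using B by simp
      define V where "V z = U z / complex_of_real B" for z
      have [measurable]: "V \<in> borel_measurable P"
        unfolding V_def by measurable
      have "(\<integral>\<^sup>+z. ennreal (norm (V z) powr p) \<partial>P) = (\<integral>\<^sup>+z. ennreal (1 / B powr p) * ennreal (norm (U z) powr p) \<partial>P)"
        using B0 by (simp add: V_def norm_divide powr_divide ennreal_mult'[symmetric])
      also have "\<dots> = ennreal (1 / B powr p) * ennreal (B powr p)"
        by (subst nn_integral_cmult) (simp_all add: B(3))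
      also have "\<dots> = 1"
        using B0 by (simp add: ennreal_mult'[symmetric])
      finally have V: "(\<integral>\<^sup>+\<xi>. ennreal (norm (?A V \<xi>) powr q) \<partial>lborel) \<le> ennreal C"
        by (intro CU) auto
      have "?A U \<xi> = (\<integral>z. complex_of_real B * (V z * wave (S z) \<xi>) \<partial>P)" for \<xi>
        using B0 by (simp add: V_def)
      then have AU: "?A U \<xi> = complex_of_real B * ?A V \<xi>" for \<xi>
        by simp
      have "(\<integral>\<^sup>+\<xi>. ennreal (norm (?A U \<xi>) powr q) \<partial>lborel) = (\<integral>\<^sup>+\<xi>. ennreal (B powr q) * ennreal (norm (?A V \<xi>) powr q) \<partial>lborel)"
        unfolding AU using B0 by (simp add: norm_mult powr_mult ennreal_mult'[symmetric])
      also have "\<dots> = ennreal (B powr q) * (\<integral>\<^sup>+\<xi>. ennreal (norm (?A V \<xi>) powr q) \<partial>lborel)"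
        by (rule nn_integral_cmult) measurable
      also have "\<dots> \<le> ennreal (B powr q) * ennreal C"
        by (intro mult_left_mono V) simp
      also have "\<dots> = ennreal ((C powr (1 / q) * B) powr q)"
        using q C B0 by (simp add: ennreal_mult'[symmetric] powr_mult powr_powr mult.commute)
      finally show ?thesis .
    qed
    then have "Lp_norm (ennreal q) lborel (?A U) \<le> ennreal (C powr (1 / q) * B)"
      using q C B by (intro Lp_norm_le) auto
    then show "Lp_norm (ennreal q) lborel (?A U) \<le> ennreal (C powr (1 / q)) * Lp_norm (ennreal p) P U"
      by (simp add: B ennreal_mult')
  qed (use C in simp)
qed

end

section \<open>Product measures and iterated convolutions\<close>

lemma finite_measure_PiM:
  fixes \<mu> :: "nat \<Rightarrow> 'a measure"
  assumes "\<And>i. finite_measure (\<mu> i)" "finite I"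
  shows "finite_measure (PiM I \<mu>)"
proof -
  interpret product_sigma_finite \<mu>
    using assms(1) by (simp add: product_sigma_finite_def finite_measure.sigma_finite_measure)
  have "emeasure (PiM I \<mu>) (space (PiM I \<mu>)) = (\<Prod>i\<in>I. emeasure (\<mu> i) (space (\<mu> i)))"
    using assms(2) by (simp add: space_PiM emeasure_PiM)
  also have "\<dots> \<noteq> \<infinity>"
    using assms finite_measure.emeasure_finite[OF assms(1)] by (simp add: ennreal_prod_eq_top)
  finally show ?thesis by (rule finite_measureI)
qed

lemma iterated_convolution_Suc:
  "k \<ge> 1 \<Longrightarrow> iterated_convolution \<mu> (Suc k) = convolution (iterated_convolution \<mu> k) (\<mu> (Suc k))"
  by (simp add: iterated_convolution_def)

lemma iterated_convolution_one: "iterated_convolution \<mu> (Suc 0) = \<mu> 1"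
  by (simp add: iterated_convolution_def)

text \<open>Induction on \<open>k\<close>: the last factor of the product measure is split off by
  Fubini, which matches the double integral that defines the convolution.\<close>

lemma iterated_convolution_eq_distr:
  fixes \<mu> :: "nat \<Rightarrow> 'a::ordered_euclidean_space measure"
  assumes fin: "\<And>i. finite_measure (\<mu> i)" and sets: "\<And>i. sets (\<mu> i) = sets borel" and k: "k \<ge> 1"
  shows "iterated_convolution \<mu> k = distr (PiM {1..k} \<mu>) borel (\<lambda>x. \<Sum>i=1..k. x i)"
proof -
  interpret product_sigma_finite \<mu>
    using fin by (simp add: product_sigma_finite_def finite_measure.sigma_finite_measure)
  note [measurable_cong] = sets
  show ?thesis
    using k
  proof (induction k rule: nat_induct_at_least)
    case base
    have "distr (PiM {1} \<mu>) borel (\<lambda>x. x 1) = distr (PiM {1} \<mu>) (\<mu> 1) (\<lambda>x. x 1)"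
      by (rule distr_cong) (auto simp: sets)
    then show ?case
      using distr_singleton[of 1] by (simp add: iterated_convolution_one)
  next
    case (Suc k)
    have ins: "{1..Suc k} = insert (Suc k) {1..k}" by auto
    have finP: "finite_measure (distr (PiM {1..k} \<mu>) borel (\<lambda>x. \<Sum>i=1..k. x i))"
      by (intro finite_measure.finite_measure_distr finite_measure_PiM fin) auto
    have "iterated_convolution \<mu> (Suc k) = convolution (distr (PiM {1..k} \<mu>) borel (\<lambda>x. \<Sum>i=1..k. x i)) (\<mu> (Suc k))"
      using Suc by (simp add: iterated_convolution_Suc)
    also have "\<dots> = distr (PiM {1..Suc k} \<mu>) borel (\<lambda>x. \<Sum>i=1..Suc k. x i)"
    proof (rule measure_eqI)
      fix A assume "A \<in> sets (convolution (distr (PiM {1..k} \<mu>) borel (\<lambda>x. \<Sum>i=1..k. x i)) (\<mu> (Suc k)))"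
      then have [measurable]: "A \<in> sets borel" by simp
      interpret S: sigma_finite_measure "\<mu> (Suc k)" by (rule sigma_finite_measures)
      have "emeasure (convolution (distr (PiM {1..k} \<mu>) borel (\<lambda>x. \<Sum>i=1..k. x i)) (\<mu> (Suc k))) A
        = (\<integral>\<^sup>+x. \<integral>\<^sup>+y. indicator A (x + y) \<partial>\<mu> (Suc k) \<partial>distr (PiM {1..k} \<mu>) borel (\<lambda>x. \<Sum>i=1..k. x i))"
        by (rule convolution_emeasure') (use finP fin sets in simp_all)
      also have "\<dots> = (\<integral>\<^sup>+x. \<integral>\<^sup>+y. indicator A ((\<Sum>i=1..k. x i) + y) \<partial>\<mu> (Suc k) \<partial>PiM {1..k} \<mu>)"
        by (rule nn_integral_distr) measurable
      also have "\<dots> = (\<integral>\<^sup>+x. indicator A (\<Sum>i=1..Suc k. x i) \<partial>PiM {1..Suc k} \<mu>)"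
      proof -
        \<comment> \<open>The updated index lies outside \<open>{1..k}\<close>, so the first
          \<open>k\<close> summands do not change.\<close>
        have "(\<Sum>i\<in>insert (Suc k) {1..k}. (x(Suc k := y)) i) = (\<Sum>i=1..k. x i) + y" for x :: "nat \<Rightarrow> 'a" and y
        proof -
          have "(\<Sum>i=1..k. (x(Suc k := y)) i) = (\<Sum>i=1..k. x i)"
            by (rule sum.cong) auto
          then show ?thesis by (subst sum.insert) (auto simp: add.commute[of y])
        qed
        moreover have "(\<integral>\<^sup>+x. indicator A (\<Sum>i\<in>insert (Suc k) {1..k}. x i) \<partial>PiM (insert (Suc k) {1..k}) \<mu>)
          = (\<integral>\<^sup>+x. \<integral>\<^sup>+y. indicator A (\<Sum>i\<in>insert (Suc k) {1..k}. (x(Suc k := y)) i) \<partial>\<mu> (Suc k) \<partial>PiM {1..k} \<mu>)"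
          by (rule product_nn_integral_insert) auto
        ultimately show ?thesis
          by (simp only: ins)
      qed
      also have "\<dots> = emeasure (distr (PiM {1..Suc k} \<mu>) borel (\<lambda>x. \<Sum>i=1..Suc k. x i)) A"
        by (subst nn_integral_indicator[symmetric], simp, subst nn_integral_distr) auto
      finally show "emeasure (convolution (distr (PiM {1..k} \<mu>) borel (\<lambda>x. \<Sum>i=1..k. x i)) (\<mu> (Suc k))) A
        = emeasure (distr (PiM {1..Suc k} \<mu>) borel (\<lambda>x. \<Sum>i=1..Suc k. x i)) A" .
    qed simp
    finally show ?case .
  qed
qed

text \<open>Fubini for the product measure; the characters multiply to the character at the sum of
  the variables, which is how the sum map enters.\<close>

lemma fourier_measure_prod_eq:
  fixes \<mu> :: "nat \<Rightarrow> 'a::ordered_euclidean_space measure" and f :: "nat \<Rightarrow> 'a \<Rightarrow> complex"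
  assumes fin: "\<And>i. finite_measure (\<mu> i)" and sets: "\<And>i. sets (\<mu> i) = sets borel" and I: "finite I"
    and f: "\<And>i. i \<in> I \<Longrightarrow> integrable (\<mu> i) (f i)"
  shows "(\<Prod>i\<in>I. fourier_measure (f i) (\<mu> i) \<xi>) = (\<integral>x. (\<Prod>i\<in>I. f i (x i)) * wave (\<Sum>i\<in>I. x i) \<xi> \<partial>PiM I \<mu>)"
proof -
  interpret product_sigma_finite \<mu>
    using fin by (simp add: product_sigma_finite_def finite_measure.sigma_finite_measure)
  note [measurable_cong] = sets
  have int: "integrable (\<mu> i) (\<lambda>x. f i x * wave x \<xi>)" if "i \<in> I" for i
    using f[OF that] borel_measurable_integrable[OF f[OF that]]
    by (intro Bochner_Integration.integrable_bound[OF f[OF that]]) (auto simp: norm_mult)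
  have "(\<Prod>i\<in>I. fourier_measure (f i) (\<mu> i) \<xi>) = (\<integral>x. (\<Prod>i\<in>I. f i (x i) * wave (x i) \<xi>) \<partial>PiM I \<mu>)"
    by (simp add: fourier_measure_wave product_integral_prod[OF I int])
  then show ?thesis
    by (simp add: prod.distrib wave_sum)
qed

text \<open>By Tonelli the integral of the \<open>p\<close>-th power factors over the
  coordinates.\<close>

lemma Lp_norm_PiM_prod:
  fixes f :: "nat \<Rightarrow> 'a \<Rightarrow> complex"
  assumes fin: "\<And>i. finite_measure (\<mu> i)" and I: "finite I" and p: "p > 0"
    and f: "\<And>i. i \<in> I \<Longrightarrow> f i \<in> Lp_space (ennreal p) (\<mu> i)"
  shows "Lp_norm (ennreal p) (PiM I \<mu>) (\<lambda>x. \<Prod>i\<in>I. f i (x i)) \<le> (\<Prod>i\<in>I. Lp_norm (ennreal p) (\<mu> i) (f i))"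
proof -
  interpret product_sigma_finite \<mu>
    using fin by (simp add: product_sigma_finite_def finite_measure.sigma_finite_measure)
  have [measurable]: "i \<in> I \<Longrightarrow> f i \<in> borel_measurable (\<mu> i)" for i
    using f by (simp add: Lp_space_def)
  have "\<exists>B. 0 \<le> B \<and> Lp_norm (ennreal p) (\<mu> i) (f i) = ennreal B \<and>
    (\<integral>\<^sup>+x. ennreal (norm (f i x) powr p) \<partial>\<mu> i) = ennreal (B powr p)" if "i \<in> I" for i
    using Lp_norm_finiteE[OF p, of "\<mu> i" "f i"] f[OF that] by (auto simp: Lp_space_def)
  then obtain B where B: "\<And>i. i \<in> I \<Longrightarrow> 0 \<le> B i" "\<And>i. i \<in> I \<Longrightarrow> Lp_norm (ennreal p) (\<mu> i) (f i) = ennreal (B i)"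
    "\<And>i. i \<in> I \<Longrightarrow> (\<integral>\<^sup>+x. ennreal (norm (f i x) powr p) \<partial>\<mu> i) = ennreal (B i powr p)"
    by metis
  have "(\<integral>\<^sup>+x. ennreal (norm (\<Prod>i\<in>I. f i (x i)) powr p) \<partial>PiM I \<mu>) = (\<integral>\<^sup>+x. (\<Prod>i\<in>I. ennreal (norm (f i (x i)) powr p)) \<partial>PiM I \<mu>)"
    by (simp add: prod_norm[symmetric] prod_powr_distrib prod_ennreal)
  also have "\<dots> = (\<Prod>i\<in>I. \<integral>\<^sup>+x. ennreal (norm (f i x) powr p) \<partial>\<mu> i)"
    by (rule product_nn_integral_prod[OF I]) measurable
  also have "\<dots> = ennreal ((\<Prod>i\<in>I. B i) powr p)"
    by (simp add: B prod_ennreal prod_powr_distrib cong: prod.cong)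
  finally have "Lp_norm (ennreal p) (PiM I \<mu>) (\<lambda>x. \<Prod>i\<in>I. f i (x i)) \<le> ennreal (\<Prod>i\<in>I. B i)"
    using p B by (intro Lp_norm_le prod_nonneg) auto
  then show ?thesis
    by (simp add: B prod_ennreal cong: prod.cong)
qed

text \<open>The bound \<open>norm (f x) \<le> 1 + norm (f x) powr p\<close> suffices, as constants
  are integrable for a finite measure.\<close>

lemma (in finite_measure) Lp_space_integrable:
  fixes f :: "'a \<Rightarrow> complex"
  assumes p: "p \<ge> 1" and f: "f \<in> Lp_space (ennreal p) M"
  shows "integrable M f"
proof -
  have [measurable]: "f \<in> borel_measurable M" and fin: "Lp_norm (ennreal p) M f < \<infinity>"
    using f by (auto simp: Lp_space_def)
  obtain B where B: "(\<integral>\<^sup>+x. ennreal (norm (f x) powr p) \<partial>M) = ennreal (B powr p)"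
    using Lp_norm_finiteE[OF _ fin] p by auto
  have "integrable M (\<lambda>x. norm (f x) powr p)"
    using B by (intro integrableI_nonneg) auto
  then have int: "integrable M (\<lambda>x. 1 + norm (f x) powr p)"
    by simp
  have "norm (f x) \<le> norm (1 + norm (f x) powr p)" for x
  proof (cases "norm (f x) \<le> 1")
    case False
    then have "norm (f x) powr 1 \<le> norm (f x) powr p"
      using p by (intro powr_mono) auto
    then show ?thesis using False by simp
  qed (simp add: add_increasing2)
  then show ?thesis
    by (intro Bochner_Integration.integrable_bound[OF int]) auto
qed

section \<open>The two estimates for products of transforms\<close>

text \<open>The product measure with the sum map is an instance of \<open>ac_image\<close>,
  \<open>g\<close> being the density of the convolution. The general bound is applied to the tensor
  product \<open>U\<close> of the \<open>f i\<close>, whose norm is controlled by the product of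
  theirs.\<close>

lemma prod_fourier_Lq_bound:
  fixes \<mu> :: "nat \<Rightarrow> 'a::ordered_euclidean_space measure"
  assumes fin: "\<And>i. finite_measure (\<mu> i)" and sets: "\<And>i. sets (\<mu> i) = sets borel" and k: "k \<ge> 1"
    and p: "p > 1" and q: "q \<ge> 2" "q \<ge> p / (p - 1)"
    and conv: "measure_in_Lp (convolution_exponent p q) (iterated_convolution \<mu> k)"
  obtains C where "C > 0" and "\<And>f :: nat \<Rightarrow> 'a \<Rightarrow> complex. (\<And>i. i \<in> {1..k} \<Longrightarrow> f i \<in> Lp_space (ennreal p) (\<mu> i)) \<Longrightarrow>
    Lp_norm (ennreal q) lborel (\<lambda>\<xi>. \<Prod>i = 1..k. fourier_measure (f i) (\<mu> i) \<xi>)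
      \<le> ennreal C * (\<Prod>i = 1..k. Lp_norm (ennreal p) (\<mu> i) (f i))"
proof -
  note [measurable_cong] = sets
  define P where "P = PiM {1..k} \<mu>"
  define S :: "(nat \<Rightarrow> 'a) \<Rightarrow> 'a" where "S x = (\<Sum>i=1..k. x i)" for x
  obtain g :: "'a \<Rightarrow> real" where g: "\<And>x. 0 \<le> g x" "g \<in> Lp_space (convolution_exponent p q) lborel"
    "iterated_convolution \<mu> k = density lborel (\<lambda>x. ennreal (g x))"
    using conv by (auto simp: measure_in_Lp_def)
  interpret ac_image P S g
  proof (intro ac_image.intro ac_image_axioms.intro)
    show "finite_measure P" unfolding P_def by (intro finite_measure_PiM fin) auto
    show "S \<in> P \<rightarrow>\<^sub>M borel" unfolding P_def S_def by measurable
    show "g \<in> borel_measurable borel" using g by (simp add: Lp_space_def)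
    show "distr P borel S = density lborel (\<lambda>x. ennreal (g x))"
      using iterated_convolution_eq_distr[OF fin sets k] g by (simp add: P_def S_def[abs_def])
  qed (rule g)
  obtain C where C: "C > 0" "\<And>U :: (nat \<Rightarrow> 'a) \<Rightarrow> complex. U \<in> borel_measurable P \<Longrightarrow> Lp_norm (ennreal p) P U < \<infinity> \<Longrightarrow>
       Lp_norm (ennreal q) lborel (\<lambda>\<xi>. \<integral>z. U z * wave (S z) \<xi> \<partial>P) \<le> ennreal C * Lp_norm (ennreal p) P U"
  proof (rule fourier_image_bound[OF p q g(2)], goal_cases)
    case (1 C)
    from 1(2,3) show ?case by (rule 1(1))
  qed
  show ?thesis
  proof (rule that[OF C(1)])
    fix f :: "nat \<Rightarrow> 'a \<Rightarrow> complex"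
    assume f: "\<And>i. i \<in> {1..k} \<Longrightarrow> f i \<in> Lp_space (ennreal p) (\<mu> i)"
    define U where "U x = (\<Prod>i=1..k. f i (x i))" for x
    have fm: "i \<in> {1..k} \<Longrightarrow> f i \<in> borel_measurable (\<mu> i)" for i
      using f by (simp add: Lp_space_def)
    have U: "U \<in> borel_measurable P"
      unfolding U_def P_def by (intro borel_measurable_prod) (rule measurable_compose[OF measurable_component_singleton], auto intro: fm)
    have UL: "Lp_norm (ennreal p) P U \<le> (\<Prod>i = 1..k. Lp_norm (ennreal p) (\<mu> i) (f i))"
      unfolding U_def P_def by (rule Lp_norm_PiM_prod) (use fin p f in auto)
    also have "\<dots> < \<infinity>"
      using f by (auto simp: Lp_space_def less_top[symmetric] ennreal_prod_eq_top)
    finally have "Lp_norm (ennreal p) P U < \<infinity>" .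
    then have "Lp_norm (ennreal q) lborel (\<lambda>\<xi>. \<integral>z. U z * wave (S z) \<xi> \<partial>P) \<le> ennreal C * Lp_norm (ennreal p) P U"
      by (intro C U)
    also have "\<dots> \<le> ennreal C * (\<Prod>i = 1..k. Lp_norm (ennreal p) (\<mu> i) (f i))"
      by (intro mult_left_mono UL) simp
    also have "(\<lambda>\<xi>. \<integral>z. U z * wave (S z) \<xi> \<partial>P) = (\<lambda>\<xi>. \<Prod>i = 1..k. fourier_measure (f i) (\<mu> i) \<xi>)"
      using fourier_measure_prod_eq[OF fin sets, where I = "{1..k}" and f = f]
        finite_measure.Lp_space_integrable[OF fin less_imp_le[OF p] f]
      by (simp add: U_def[abs_def] P_def S_def[abs_def])
    finally show "Lp_norm (ennreal q) lborel (\<lambda>\<xi>. \<Prod>i = 1..k. fourier_measure (f i) (\<mu> i) \<xi>)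
      \<le> ennreal C * (\<Prod>i = 1..k. Lp_norm (ennreal p) (\<mu> i) (f i))" .
  qed
qed

lemma iterated_convolution_cong:
  assumes "\<And>i. i \<in> {1..k} \<Longrightarrow> \<mu> i = \<nu> i" "k \<ge> 1"
  shows "iterated_convolution \<mu> k = iterated_convolution \<nu> k"
proof -
  have "map \<mu> [2..<Suc k] = map \<nu> [2..<Suc k]"
    using assms by (intro map_cong) auto
  moreover have "\<mu> 1 = \<nu> 1"
    using assms by simp
  ultimately show ?thesis
    by (simp only: iterated_convolution_def)
qed

text \<open>Characters have modulus 1, so each factor is bounded at every frequency by the norm of
  its own function; the bounds multiply.\<close>

lemma prod_fourier_Linfty_bound:
  fixes \<mu> :: "nat \<Rightarrow> 'a::euclidean_space measure" and f :: "nat \<Rightarrow> 'a \<Rightarrow> complex"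
  assumes fin: "\<And>i. i \<in> I \<Longrightarrow> finite_measure (\<mu> i)" and sets: "\<And>i. i \<in> I \<Longrightarrow> sets (\<mu> i) = sets borel"
    and f: "\<And>i. i \<in> I \<Longrightarrow> f i \<in> Lp_space 1 (\<mu> i)"
  shows "Lp_norm \<infinity> lborel (\<lambda>\<xi>. \<Prod>i\<in>I. fourier_measure (f i) (\<mu> i) \<xi>) \<le> (\<Prod>i\<in>I. Lp_norm 1 (\<mu> i) (f i))"
proof -
  have m: "fourier_measure (f i) (\<mu> i) \<in> borel_measurable borel" if "i \<in> I" for i
  proof -
    have "f i \<in> borel_measurable borel"
      using f[OF that] sets[OF that] by (simp add: Lp_space_def cong: measurable_cong_sets)
    then show ?thesis
      using fin[OF that] sets[OF that]
      by (intro fourier_measure_measurable) (auto simp: finite_measure.sigma_finite_measure)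
  qed
  have b: "ennreal (norm (fourier_measure (f i) (\<mu> i) \<xi>)) \<le> Lp_norm 1 (\<mu> i) (f i)" if "i \<in> I" for i \<xi>
  proof -
    have "ennreal (norm (fourier_measure (f i) (\<mu> i) \<xi>)) \<le> (\<integral>\<^sup>+x. ennreal (norm (f i x * wave x \<xi>)) \<partial>\<mu> i)"
      unfolding fourier_measure_wave by (rule ennreal_norm_integral_le)
    also have "\<dots> = Lp_norm 1 (\<mu> i) (f i)"
      by (simp add: Lp_norm_def Let_def norm_mult top.not_eq_extremum)
    finally show ?thesis .
  qed
  have "ennreal (norm (\<Prod>i\<in>I. fourier_measure (f i) (\<mu> i) \<xi>)) \<le> (\<Prod>i\<in>I. Lp_norm 1 (\<mu> i) (f i))" for \<xi>
    using b[of _ \<xi>]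
  proof (induction I rule: infinite_finite_induct)
    case (insert i I)
    then show ?case
      by (simp add: norm_mult ennreal_mult' mult_mono)
  qed simp_all
  \<comment> \<open>Measurability matters here: \<open>esssup\<close> of a non-measurable function
    is the top element by definition.\<close>
  moreover have "(\<lambda>\<xi>. ennreal (norm (\<Prod>i\<in>I. fourier_measure (f i) (\<mu> i) \<xi>))) \<in> borel_measurable lborel"
    using m by measurable
  ultimately show ?thesis
    by (simp add: Lp_norm_def esssup_I)
qed

theorem proposition3p4:
  fixes k :: nat and \<mu> :: "nat \<Rightarrow> (real ^ 'd) measure"
  assumes k: "k \<ge> 2"
    and borel: "\<And>i. i \<in> {1..k} \<Longrightarrow> sets (\<mu> i) = sets borel"
    and finite: "\<And>i. i \<in> {1..k} \<Longrightarrow> finite_measure (\<mu> i)"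
    and nonzero: "\<And>i. i \<in> {1..k} \<Longrightarrow> emeasure (\<mu> i) (space (\<mu> i)) \<noteq> 0"
    and compact_support: "\<And>i. i \<in> {1..k} \<Longrightarrow> compact (msupport (\<mu> i))"
  shows "(\<forall>p q :: real. p > 1 \<longrightarrow> q \<ge> max 2 (hoelder_conjugate p) \<longrightarrow>
            measure_in_Lp (convolution_exponent p q) (iterated_convolution \<mu> k) \<longrightarrow>
            (\<exists>C :: real. C > 0 \<and>
              (\<forall>f :: nat \<Rightarrow> real ^ 'd \<Rightarrow> complex.
                (\<forall>i \<in> {1..k}. f i \<in> Lp_space (ennreal p) (\<mu> i)) \<longrightarrow>
                Lp_norm (ennreal q) lborel (\<lambda>\<xi>. \<Prod>i = 1..k. fourier_measure (f i) (\<mu> i) \<xi>)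
                  \<le> ennreal C * (\<Prod>i = 1..k. Lp_norm (ennreal p) (\<mu> i) (f i)))))
       \<and> (\<exists>C :: real. C > 0 \<and>
            (\<forall>f :: nat \<Rightarrow> real ^ 'd \<Rightarrow> complex.
              (\<forall>i \<in> {1..k}. f i \<in> Lp_space 1 (\<mu> i)) \<longrightarrow>
              Lp_norm \<infinity> lborel (\<lambda>\<xi>. \<Prod>i = 1..k. fourier_measure (f i) (\<mu> i) \<xi>)
                \<le> ennreal C * (\<Prod>i = 1..k. Lp_norm 1 (\<mu> i) (f i))))"
proof (intro conjI allI impI)
  fix p q :: real
  assume p: "p > 1" and q: "q \<ge> max 2 (hoelder_conjugate p)"
    and conv: "measure_in_Lp (convolution_exponent p q) (iterated_convolution \<mu> k)"
  \<comment> \<open>Nothing is assumed of \<open>\<mu> i\<close> outside \<open>{1..k}\<close>,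
    whereas \<open>prod_fourier_Lq_bound\<close> asks for finite Borel measures at every index;
    \<open>\<mu> 1\<close> fills the gaps.\<close>
  define \<nu> where "\<nu> i = (if i \<in> {1..k} then \<mu> i else \<mu> 1)" for i
  have \<nu>: "\<And>i. finite_measure (\<nu> i)" "\<And>i. sets (\<nu> i) = sets borel" "\<And>i. i \<in> {1..k} \<Longrightarrow> \<nu> i = \<mu> i"
    using k borel finite by (auto simp: \<nu>_def)
  have "measure_in_Lp (convolution_exponent p q) (iterated_convolution \<nu> k)"
    using conv k iterated_convolution_cong[of k \<nu> \<mu>] \<nu>(3) by simp
  then obtain C where C: "C > 0" "\<And>f :: nat \<Rightarrow> real ^ 'd \<Rightarrow> complex. (\<And>i. i \<in> {1..k} \<Longrightarrow> f i \<in> Lp_space (ennreal p) (\<nu> i)) \<Longrightarrow>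
    Lp_norm (ennreal q) lborel (\<lambda>\<xi>. \<Prod>i = 1..k. fourier_measure (f i) (\<nu> i) \<xi>)
      \<le> ennreal C * (\<Prod>i = 1..k. Lp_norm (ennreal p) (\<nu> i) (f i))"
    using prod_fourier_Lq_bound[of \<nu> k p q] \<nu> k p q by (auto simp: hoelder_conjugate_def)
  have "(\<Prod>i = 1..k. fourier_measure (f i) (\<nu> i) \<xi>) = (\<Prod>i = 1..k. fourier_measure (f i) (\<mu> i) \<xi>)"
    "(\<Prod>i = 1..k. Lp_norm (ennreal p) (\<nu> i) (f i)) = (\<Prod>i = 1..k. Lp_norm (ennreal p) (\<mu> i) (f i))"
    for f :: "nat \<Rightarrow> real ^ 'd \<Rightarrow> complex" and \<xi>
    using \<nu>(3) by (auto intro!: prod.cong)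
  note C' = C(2)[unfolded this]
  show "\<exists>C :: real. C > 0 \<and>
      (\<forall>f :: nat \<Rightarrow> real ^ 'd \<Rightarrow> complex.
        (\<forall>i \<in> {1..k}. f i \<in> Lp_space (ennreal p) (\<mu> i)) \<longrightarrow>
        Lp_norm (ennreal q) lborel (\<lambda>\<xi>. \<Prod>i = 1..k. fourier_measure (f i) (\<mu> i) \<xi>)
          \<le> ennreal C * (\<Prod>i = 1..k. Lp_norm (ennreal p) (\<mu> i) (f i)))"
    using C(1) C' \<nu>(3) by (intro exI[of _ C] conjI allI impI) auto
next
  show "\<exists>C :: real. C > 0 \<and>
      (\<forall>f :: nat \<Rightarrow> real ^ 'd \<Rightarrow> complex.
        (\<forall>i \<in> {1..k}. f i \<in> Lp_space 1 (\<mu> i)) \<longrightarrow>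
        Lp_norm \<infinity> lborel (\<lambda>\<xi>. \<Prod>i = 1..k. fourier_measure (f i) (\<mu> i) \<xi>)
          \<le> ennreal C * (\<Prod>i = 1..k. Lp_norm 1 (\<mu> i) (f i)))"
    using prod_fourier_Linfty_bound[of "{1..k}" \<mu>] borel finite by (intro exI[of _ 1]) auto
qed

end
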